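(* Let $\mathbb X=(X^1,\dots,X^n)$ be a continuous $\mathbb R^n$-valued process. Then $\mathbb X$ admits all its mutual brackets if and only if $\mathbb X$ admits a global quadratic variation.
   Context: Fix $T>0$ and a probability space $(\Omega,\mathcal F,\mathbb P)$. Processes on $[0,T]$ are extended by $\mathbb X_t=\mathbb X_0$ for $t\le0$ and $\mathbb X_t=\mathbb X_T$ for $t\ge T$. $\mathscr C([0,T])$ is the space of real continuous processes with the topology of uniform convergence in probability (ucp) on $[0,T]$. Mutual brackets: $\mathbb X$ admits all its mutual brackets if for all $1\le i,j\le n$ the covariation $[X^i,X^j]$ exists, i.e. $\frac1\epsilon\int_0^t(X^i_{s+\epsilon}-X^i_s)(X^j_{s+\epsilon}-X^j_s)ds$ converges in probability as $\epsilon\to0$ for every $t\in[0,T]$ and the limiting process admits a continuous version. Global quadratic variation: with $B=\mathbb R^n$ and $\chi=(B\hat\otimes_\pi B)^*$ (identified with bilinear forms on $\mathbb R^n$, i.e. $n\times n$ matrices), $\mathbb X$ admits a global quadratic variation if (H1) every sequence $\epsilon_n\downarrow0$ has a subsequence $(\epsilon_{n_k})$ with $\sup_k\int_0^T\epsilon_{n_k}^{-1}\|(\mathbb X_{s+\epsilon_{n_k}}-\mathbb X_s)\otimes(\mathbb X_{s+\epsilon_{n_k}}-\mathbb X_s)\|_{\chi^*}ds<\infty$ a.s.; (H2)(i) there is a map $[\mathbb X]:\chi\to\mathscr C([0,T])$ such that $\int_0^\cdot\langle\phi,\epsilon^{-1}(\mathbb X_{s+\epsilon}-\mathbb X_s)\otimes(\mathbb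 X_{s+\epsilon}-\mathbb X_s)\rangle ds\to[\mathbb X](\phi)$ ucp as $\epsilon\to0+$ for every $\phi\in\chi$; (H2)(ii) there is a measurable process $\widetilde{[\mathbb X]}:\Omega\times[0,T]\to\chi^*$ with a.s. (càdlàg) bounded variation paths and $\widetilde{[\mathbb X]}(\cdot,t)(\phi)=[\mathbb X](\phi)(\cdot,t)$ a.s. for all $\phi\in\chi$, $t\in[0,T]$. *)

theory Defs
  imports "HOL-Probability.Probability"
begin

subsection \<open>Processes on \<open>[0,T]\<close>\<close>

text \<open>Processes are written \<open>X t \<omega>\<close>; only the times \<open>t \<in> {0..T}\<close> matter, the values at other
  times are never used.\<close>

definition continuous_process ::
  "'w measure \<Rightarrow> real \<Rightarrow> (real \<Rightarrow> 'w \<Rightarrow> 'b::topological_space) \<Rightarrow> bool" where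
  "continuous_process M T X \<longleftrightarrow>
     (\<forall>t\<in>{0..T}. X t \<in> borel_measurable M) \<and>
     (\<forall>\<omega>\<in>space M. continuous_on {0..T} (\<lambda>t. X t \<omega>))"

text \<open>Extension by \<open>X\<^sub>0\<close> to the left of \<open>0\<close> and by \<open>X\<^sub>T\<close> to the right of \<open>T\<close>.\<close>

definition extend :: "real \<Rightarrow> (real \<Rightarrow> 'w \<Rightarrow> 'b) \<Rightarrow> real \<Rightarrow> 'w \<Rightarrow> 'b" where
  "extend T X t = X (max 0 (min T t))"

definition increment ::
  "real \<Rightarrow> (real \<Rightarrow> 'w \<Rightarrow> 'b::minus) \<Rightarrow> real \<Rightarrow> real \<Rightarrow> 'w \<Rightarrow> 'b" where
  "increment T X \<epsilon> s \<omega> = extend T X (s + \<epsilon>) \<omega> - extend T X s \<omega>"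

definition converges_in_prob ::
  "'w measure \<Rightarrow> (real \<Rightarrow> 'w \<Rightarrow> real) \<Rightarrow> ('w \<Rightarrow> real) \<Rightarrow> real filter \<Rightarrow> bool" where
  "converges_in_prob M Y L F \<longleftrightarrow>
     (\<forall>\<delta>>0. ((\<lambda>\<epsilon>. measure M {\<omega>\<in>space M. \<bar>Y \<epsilon> \<omega> - L \<omega>\<bar> > \<delta>}) \<longlongrightarrow> 0) F)"

text \<open>Only meaningful for processes with bounded paths on \<open>{0..T}\<close>, e.g. continuous ones.\<close>

definition converges_ucp ::
  "'w measure \<Rightarrow> real \<Rightarrow> (real \<Rightarrow> real \<Rightarrow> 'w \<Rightarrow> real) \<Rightarrow> (real \<Rightarrow> 'w \<Rightarrow> real) \<Rightarrow> real filter \<Rightarrow> bool"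
where
  "converges_ucp M T Y L F \<longleftrightarrow>
     converges_in_prob M (\<lambda>\<epsilon> \<omega>. SUP t\<in>{0..T}. \<bar>Y \<epsilon> t \<omega> - L t \<omega>\<bar>) (\<lambda>\<omega>. 0) F"


subsection \<open>Covariations and mutual brackets\<close>

definition covariation_approx ::
  "real \<Rightarrow> (real \<Rightarrow> 'w \<Rightarrow> real) \<Rightarrow> (real \<Rightarrow> 'w \<Rightarrow> real) \<Rightarrow> real \<Rightarrow> real \<Rightarrow> 'w \<Rightarrow> real" where
  "covariation_approx T X Y \<epsilon> t \<omega> =
     1 / \<epsilon> * (LINT s:{0..t}|lborel. increment T X \<epsilon> s \<omega> * increment T Y \<epsilon> s \<omega>)"

text \<open>\<open>L\<close> is the pointwise limit in probability as \<open>\<epsilon> \<rightarrow> 0+\<close>, \<open>C\<close> its continuous version.\<close>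

definition covariation_exists ::
  "'w measure \<Rightarrow> real \<Rightarrow> (real \<Rightarrow> 'w \<Rightarrow> real) \<Rightarrow> (real \<Rightarrow> 'w \<Rightarrow> real) \<Rightarrow> bool" where
  "covariation_exists M T X Y \<longleftrightarrow>
     (\<exists>L. (\<forall>t\<in>{0..T}. L t \<in> borel_measurable M \<and>
             converges_in_prob M (\<lambda>\<epsilon>. covariation_approx T X Y \<epsilon> t) (L t) (at_right 0)) \<and>
          (\<exists>C. continuous_process M T C \<and> (\<forall>t\<in>{0..T}. AE \<omega> in M. C t \<omega> = L t \<omega>)))"

definition admits_all_mutual_brackets ::
  "'w measure \<Rightarrow> real \<Rightarrow> (real \<Rightarrow> 'w \<Rightarrow> real ^ 'n) \<Rightarrow> bool" where
  "admits_all_mutual_brackets M T X \<longleftrightarrow>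
     (\<forall>i j. covariation_exists M T (\<lambda>t \<omega>. X t \<omega> $ i) (\<lambda>t \<omega>. X t \<omega> $ j))"


subsection \<open>Global quadratic variation\<close>

text \<open>The dual \<open>\<chi>\<close> of the projective tensor square of \<open>B\<close> is, isometrically, the space
  \<open>B \<Rightarrow>\<^sub>L B \<Rightarrow>\<^sub>L real\<close> of bounded bilinear forms: the iterated operator norm is the norm
  \<open>sup {\<bar>\<phi> x y\<bar> | norm x \<le> 1, norm y \<le> 1}\<close>. An elementary tensor \<open>x \<otimes> y\<close> acts on it by
  \<open>\<phi> \<mapsto> \<phi> x y\<close>.\<close>

type_synonym 'b chi = "'b \<Rightarrow>\<^sub>L ('b \<Rightarrow>\<^sub>L real)"

type_synonym 'b chi_dual = "'b chi \<Rightarrow>\<^sub>L real"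

lift_definition tensor :: "'b::real_normed_vector \<Rightarrow> 'b \<Rightarrow> 'b chi_dual"
  is "\<lambda>x y \<phi>. blinfun_apply (blinfun_apply \<phi> x) y"
  by (rule bounded_linear_compose[OF blinfun.bounded_linear_left blinfun.bounded_linear_left])

definition scaled_increment_tensor ::
  "real \<Rightarrow> (real \<Rightarrow> 'w \<Rightarrow> 'b::real_normed_vector) \<Rightarrow> real \<Rightarrow> real \<Rightarrow> 'w \<Rightarrow> 'b chi_dual" where
  "scaled_increment_tensor T X \<epsilon> s \<omega> =
     (1 / \<epsilon>) *\<^sub>R tensor (increment T X \<epsilon> s \<omega>) (increment T X \<epsilon> s \<omega>)"

definition bounded_variation :: "real \<Rightarrow> (real \<Rightarrow> 'b::real_normed_vector) \<Rightarrow> bool" where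
  "bounded_variation T f \<longleftrightarrow>
     (\<exists>K. \<forall>(m::nat) p. (\<forall>i\<le>m. p i \<in> {0..T}) \<and> (\<forall>i<m. p i \<le> p (Suc i)) \<longrightarrow>
        (\<Sum>i<m. norm (f (p (Suc i)) - f (p i))) \<le> K)"

definition cadlag :: "real \<Rightarrow> (real \<Rightarrow> 'b::topological_space) \<Rightarrow> bool" where
  "cadlag T f \<longleftrightarrow>
     (\<forall>t\<in>{0..<T}. (f \<longlongrightarrow> f t) (at_right t)) \<and>
     (\<forall>t\<in>{0<..T}. \<exists>l. (f \<longlongrightarrow> l) (at_left t))"

definition H1 :: "'w measure \<Rightarrow> real \<Rightarrow> (real \<Rightarrow> 'w \<Rightarrow> 'b::real_normed_vector) \<Rightarrow> bool" where
  "H1 M T X \<longleftrightarrow>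
     (\<forall>e :: nat \<Rightarrow> real. (\<forall>k. e k > 0) \<and> decseq e \<and> e \<longlonglongrightarrow> 0 \<longrightarrow>
        (\<exists>r :: nat \<Rightarrow> nat. strict_mono r \<and>
           (AE \<omega> in M. (SUP k. \<integral>\<^sup>+ s\<in>{0..T}.
              ennreal (norm (tensor (increment T X (e (r k)) s \<omega>) (increment T X (e (r k)) s \<omega>))
                / e (r k)) \<partial>lborel) < \<infinity>)))"

definition H2i ::
  "'w measure \<Rightarrow> real \<Rightarrow> (real \<Rightarrow> 'w \<Rightarrow> 'b::real_normed_vector) \<Rightarrow>
   ('b chi \<Rightarrow> real \<Rightarrow> 'w \<Rightarrow> real) \<Rightarrow> bool" where
  "H2i M T X Q \<longleftrightarrow>
     (\<forall>\<phi>. continuous_process M T (Q \<phi>) \<and>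
        converges_ucp M T
          (\<lambda>\<epsilon> t \<omega>. LINT s:{0..t}|lborel. blinfun_apply (scaled_increment_tensor T X \<epsilon> s \<omega>) \<phi>)
          (Q \<phi>) (at_right 0))"

definition H2ii ::
  "'w measure \<Rightarrow> real \<Rightarrow> ('b::real_normed_vector chi \<Rightarrow> real \<Rightarrow> 'w \<Rightarrow> real) \<Rightarrow> bool" where
  "H2ii M T Q \<longleftrightarrow>
     (\<exists>Qt :: 'w \<Rightarrow> real \<Rightarrow> 'b chi_dual.
        (\<lambda>(\<omega>, t). Qt \<omega> t) \<in> borel_measurable (M \<Otimes>\<^sub>M restrict_space borel {0..T}) \<and>
        (AE \<omega> in M. cadlag T (Qt \<omega>) \<and> bounded_variation T (Qt \<omega>)) \<and>
        (\<forall>\<phi>. \<forall>t\<in>{0..T}. AE \<omega> in M. blinfun_apply (Qt \<omega> t) \<phi> = Q \<phi> t \<omega>))"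

definition admits_global_quadratic_variation ::
  "'w measure \<Rightarrow> real \<Rightarrow> (real \<Rightarrow> 'w \<Rightarrow> 'b::real_normed_vector) \<Rightarrow> bool" where
  "admits_global_quadratic_variation M T X \<longleftrightarrow>
     H1 M T X \<and> (\<exists>Q. H2i M T X Q \<and> H2ii M T Q)"

end

theory Submission
  imports Defs
begin

text \<open>
  Write \<open>A\<^sup>i\<^sup>j\<close> for the \<open>\<epsilon>\<close>-approximation of the covariation of the components \<open>X\<^sup>i\<close> and \<open>X\<^sup>j\<close>.
  In coordinates a bilinear form on a finite-dimensional space is
  \<open>\<phi>(x, y) = \<Sum>\<^sub>i\<^sub>j \<phi>\<^sub>i\<^sub>j x\<^sub>i y\<^sub>j\<close>, hence the \<open>\<epsilon>\<close>-approximation of the global quadratic variation,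
  evaluated at \<open>\<phi>\<close>, is the finite linear combination \<open>\<Sum>\<^sub>i\<^sub>j \<phi>\<^sub>i\<^sub>j A\<^sup>i\<^sup>j\<close>
  (\<open>integral_scaled_increment_tensor\<close>). Choosing for \<open>\<phi>\<close> the coordinate form \<open>x\<^sub>i y\<^sub>j\<close> shows that a global
  quadratic variation contains all mutual brackets.

  Conversely, let all mutual brackets exist, with continuous versions \<open>C\<^sup>i\<^sup>j\<close>. Two gaps separate the
  pointwise convergence in probability \<open>A\<^sup>i\<^sup>j \<rightarrow> C\<^sup>i\<^sup>j\<close> from the global notion: uniformity in time, and
  bounded variation of the limit. Both are closed by monotonicity. For a real process \<open>Y\<close> the
  approximation of its own quadratic variation is nondecreasing in time, as the integral of a square.
  Nondecreasing processes that converge pointwise in probability to a continuous process converge ucp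
  (\<open>monotone_pointwise_imp_ucp\<close>, a stochastic version of Dini's and Polya's theorems), and their limit is
  almost surely nondecreasing (\<open>AE_mono_limit\<close>). By polarization \<open>2 A\<^sup>i\<^sup>j\<close> arises from the
  approximation for \<open>X\<^sup>i + X\<^sup>j\<close> by subtracting those for \<open>X\<^sup>i\<close> and for \<open>X\<^sup>j\<close>, so ucp convergence and
  bounded variation carry over to mixed indices (\<open>covariation_limit\<close>).

  The tensor-valued process of the global notion is then \<open>\<Sum>\<^sub>i\<^sub>j C\<^sup>i\<^sup>j e\<^sub>i \<otimes> e\<^sub>j\<close>. Finally, the
  norm of \<open>x \<otimes> x\<close> is at most \<open>\<Sum>\<^sub>i x\<^sub>i\<^sup>2\<close>, so the integrals in \<open>H1\<close> are dominated by \<open>\<Sum>\<^sub>i A\<^sup>i\<^sup>i\<close> at time \<open>T\<close>;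
  these converge in probability and are therefore almost surely bounded along a suitable subsequence.
\<close>

section \<open>Measurability of processes with continuous paths\<close>

text \<open>The strict inequality is an open condition on \<open>s\<close>, so a witness can be moved into a
  dense subset.\<close>

lemma ex_gt_dense_iff:
  fixes f :: "'a::topological_space \<Rightarrow> real"
  assumes f: "continuous_on S f" and D: "D \<subseteq> S" "S \<subseteq> closure D"
  shows "(\<exists>s\<in>S. a < f s) \<longleftrightarrow> (\<exists>s\<in>D. a < f s)"
proof
  assume "\<exists>s\<in>S. a < f s"
  then obtain s where s: "s \<in> S" "a < f s" by auto
  obtain U where U: "open U" "U \<inter> S = f -` {a<..} \<inter> S"
    using f open_greaterThan by (metis continuous_on_open_invariant)
  have "s \<in> U" "s \<in> closure D" using s U D by auto
  then obtain d where "d \<in> D" "d \<in> U"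
    using U(1) by (metis closure_iff_nhds_not_empty disjoint_iff order_refl)
  with U D show "\<exists>s\<in>D. a < f s" by blast
qed (use D in auto)

text \<open>By density the uncountable union over \<open>S\<close> is a countable one.\<close>

lemma sets_ex_gt:
  fixes F :: "'a::euclidean_space \<Rightarrow> 'w \<Rightarrow> real"
  assumes "\<And>s. s \<in> S \<Longrightarrow> F s \<in> borel_measurable M"
    and "\<And>\<omega>. \<omega> \<in> space M \<Longrightarrow> continuous_on S (\<lambda>s. F s \<omega>)"
  shows "{\<omega>\<in>space M. \<exists>s\<in>S. a < F s \<omega>} \<in> sets M"
proof -
  obtain D where D: "countable D" "D \<subseteq> S" "S \<subseteq> closure D"
    using separable by blast
  have "{\<omega>\<in>space M. \<exists>s\<in>S. a < F s \<omega>} = (\<Union>s\<in>D. {\<omega>\<in>space M. a < F s \<omega>})"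
    using ex_gt_dense_iff[OF assms(2) D(2,3)] by blast
  moreover have "{\<omega>\<in>space M. a < F s \<omega>} \<in> sets M" if "s \<in> D" for s
  proof -
    have [measurable]: "F s \<in> borel_measurable M" using assms(1) that D by auto
    show ?thesis by measurable
  qed
  ultimately show ?thesis using D(1) by auto
qed

lemma continuous_process_comb:
  fixes F G :: "real \<Rightarrow> 'w \<Rightarrow> real"
  assumes "continuous_process M T F" "continuous_process M T G"
  shows "continuous_process M T (\<lambda>t \<omega>. a * F t \<omega> + b * G t \<omega>)"
  using assms unfolding continuous_process_def
  by (auto intro!: continuous_intros borel_measurable_add borel_measurable_times)

lemma continuous_process_diff:
  fixes F G :: "real \<Rightarrow> 'w \<Rightarrow> real"
  assumes "continuous_process M T F" "continuous_process M T G"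
  shows "continuous_process M T (\<lambda>t \<omega>. F t \<omega> - G t \<omega>)"
  using continuous_process_comb[OF assms, of 1 "-1"] by simp

lemma continuous_process_sum:
  fixes F :: "'i \<Rightarrow> real \<Rightarrow> 'w \<Rightarrow> real"
  assumes "\<And>i. i \<in> I \<Longrightarrow> continuous_process M T (F i)"
  shows "continuous_process M T (\<lambda>t \<omega>. \<Sum>i\<in>I. a i * F i t \<omega>)"
  using assms unfolding continuous_process_def
  by (auto intro!: continuous_intros borel_measurable_sum borel_measurable_times)

text \<open>Continuity bounds the path; without a bound \<open>Sup\<close> would be an arbitrary number and
  say nothing about the path.\<close>

lemma sup_abs_gt_iff:
  fixes f :: "real \<Rightarrow> real"
  assumes "continuous_on {0..T} f" "0 \<le> T"
  shows "a < (SUP t\<in>{0..T}. \<bar>f t\<bar>) \<longleftrightarrow> (\<exists>t\<in>{0..T}. a < \<bar>f t\<bar>)"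
proof (rule less_cSUP_iff)
  have "compact ((\<lambda>t. \<bar>f t\<bar>) ` {0..T})"
    by (intro compact_continuous_image continuous_intros assms compact_Icc)
  then show "bdd_above ((\<lambda>t. \<bar>f t\<bar>) ` {0..T})"
    by (simp add: bounded_imp_bdd_above compact_imp_bounded)
qed (use assms in auto)

lemma abs_le_sup_abs:
  fixes f :: "real \<Rightarrow> real"
  assumes "continuous_on {0..T} f" "t \<in> {0..T}"
  shows "\<bar>f t\<bar> \<le> (SUP t\<in>{0..T}. \<bar>f t\<bar>)"
  using sup_abs_gt_iff[OF assms(1)] assms(2) by (meson atLeastAtMost_iff not_le order_trans order_refl)

lemma borel_measurable_sup_abs:
  fixes F :: "real \<Rightarrow> 'w \<Rightarrow> real"
  assumes "continuous_process M T F" "0 \<le> T"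
  shows "(\<lambda>\<omega>. SUP t\<in>{0..T}. \<bar>F t \<omega>\<bar>) \<in> borel_measurable M"
  unfolding borel_measurable_iff_greater
proof
  fix a
  have "{\<omega>\<in>space M. a < (SUP t\<in>{0..T}. \<bar>F t \<omega>\<bar>)} = {\<omega>\<in>space M. \<exists>t\<in>{0..T}. a < \<bar>F t \<omega>\<bar>}"
    using assms by (intro Collect_cong conj_cong refl sup_abs_gt_iff) (auto simp: continuous_process_def)
  also have "\<dots> \<in> sets M"
    using assms by (intro sets_ex_gt) (auto simp: continuous_process_def intro!: continuous_intros borel_measurable_abs)
  finally show "{\<omega>\<in>space M. a < (SUP t\<in>{0..T}. \<bar>F t \<omega>\<bar>)} \<in> sets M" .
qed

lemma continuous_extend:
  assumes "continuous_process M T X" "\<omega> \<in> space M" "0 \<le> T"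
  shows "continuous_on UNIV (\<lambda>s. extend T X s \<omega>)"
proof -
  have "continuous_on {0..T} (\<lambda>t. X t \<omega>)" using assms by (auto simp: continuous_process_def)
  then show ?thesis
    unfolding extend_def
    by (rule continuous_on_compose2) (use assms(3) in \<open>auto intro!: continuous_intros\<close>)
qed

text \<open>A process with continuous paths is the pointwise limit of the processes that are held constant
  on the intervals \<open>[i/(n+1), (i+1)/(n+1))\<close>, and these are jointly measurable
  because only countably many times occur in them.\<close>

lemma measurable_extend_pair:
  fixes X :: "real \<Rightarrow> 'w \<Rightarrow> real"
  assumes X: "continuous_process M T X" and "0 \<le> T"
  shows "(\<lambda>(\<omega>, s). extend T X s \<omega>) \<in> borel_measurable (M \<Otimes>\<^sub>M borel)"
proof (rule borel_measurable_LIMSEQ_metric)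
  fix n :: nat
  have [measurable]: "extend T X s \<in> borel_measurable M" for s
    using assms by (auto simp: extend_def continuous_process_def)
  have 1: "(\<lambda>p. extend T X (real_of_int i / Suc n) (fst p)) \<in> borel_measurable (M \<Otimes>\<^sub>M borel)"
    for i :: int
    by (rule measurable_compose[OF measurable_fst]) simp
  have 2: "(\<lambda>p. \<lfloor>(snd p :: real) * Suc n\<rfloor>) \<in> measurable (M \<Otimes>\<^sub>M borel) (count_space UNIV)"
    by (rule measurable_compose[OF _ measurable_real_floor]) simp
  show "(\<lambda>p. extend T X (real_of_int \<lfloor>snd p * real (Suc n)\<rfloor> / Suc n) (fst p))
      \<in> borel_measurable (M \<Otimes>\<^sub>M borel)"
    by (rule measurable_compose_countable[OF 1 2])
next
  fix p assume "p \<in> space (M \<Otimes>\<^sub>M (borel :: real measure))"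
  then have \<omega>: "fst p \<in> space M" by (auto simp: space_pair_measure)
  have lim: "(\<lambda>n. real_of_int \<lfloor>s * Suc n\<rfloor> / Suc n) \<longlonglongrightarrow> s" for s :: real
  proof (rule LIMSEQ_I)
    fix e :: real assume "0 < e"
    then obtain N where N: "1 / Suc N < e" using nat_approx_posE by blast
    have "norm (real_of_int \<lfloor>s * Suc n\<rfloor> / Suc n - s) < e" if "n \<ge> N" for n
    proof -
      have "real_of_int \<lfloor>s * Suc n\<rfloor> / Suc n - s = (real_of_int \<lfloor>s * Suc n\<rfloor> - s * Suc n) / Suc n"
        by (simp add: field_simps)
      moreover have "\<bar>real_of_int \<lfloor>s * Suc n\<rfloor> - s * Suc n\<bar> \<le> 1" by linarith
      ultimately have "norm (real_of_int \<lfloor>s * Suc n\<rfloor> / Suc n - s) \<le> 1 / Suc n"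
        by (simp add: divide_right_mono)
      also have "\<dots> \<le> 1 / Suc N" using that by (simp add: frac_le)
      finally show ?thesis using N by simp
    qed
    then show "\<exists>N. \<forall>n\<ge>N. norm (real_of_int \<lfloor>s * Suc n\<rfloor> / Suc n - s) < e" by blast
  qed
  have "isCont (\<lambda>s. extend T X s (fst p)) s" for s
    using continuous_extend[OF X \<omega> assms(2)] by (simp add: continuous_on_eq_continuous_at)
  from isCont_tendsto_compose[OF this lim]
  show "(\<lambda>n. extend T X (real_of_int \<lfloor>snd p * real (Suc n)\<rfloor> / Suc n) (fst p))
      \<longlonglongrightarrow> (case p of (\<omega>, s) \<Rightarrow> extend T X s \<omega>)"
    by (simp add: case_prod_beta)
qed

section \<open>Convergence in probability\<close>

text \<open>If the combined deviation exceeds \<open>\<delta>\<close>, then one of the finitely many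
  dominating deviations exceeds a fixed fraction of \<open>\<delta>\<close>. Differences and
  linear combinations of limits are treated with this bound, and so is ucp convergence, where
  the deviations are suprema over time.\<close>

lemma converges_in_prob_dominated:
  fixes Y :: "'i \<Rightarrow> real \<Rightarrow> 'w \<Rightarrow> real"
  assumes M: "prob_space M" and I: "finite I"
    and Y: "\<And>i. i \<in> I \<Longrightarrow> converges_in_prob M (Y i) (L i) F"
    and meas: "\<forall>\<^sub>F \<epsilon> in F. \<forall>i\<in>I. (\<lambda>\<omega>. Y i \<epsilon> \<omega> - L i \<omega>) \<in> borel_measurable M"
    and le: "\<forall>\<^sub>F \<epsilon> in F. \<forall>\<omega>\<in>space M. \<bar>Z \<epsilon> \<omega> - K \<omega>\<bar> \<le> c * (\<Sum>i\<in>I. \<bar>Y i \<epsilon> \<omega> - L i \<omega>\<bar>)"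
    and c: "0 < c"
  shows "converges_in_prob M Z K F"
  unfolding converges_in_prob_def
proof (intro allI impI)
  interpret prob_space M by fact
  fix \<delta> :: real assume \<delta>: "\<delta> > 0"
  \<comment> \<open>The summand 1 keeps the quotient meaningful for empty \<open>I\<close>.\<close>
  define \<eta> where "\<eta> = \<delta> / (c * (card I + 1))"
  have \<eta>: "\<eta> > 0" using \<delta> c by (simp add: \<eta>_def add_pos_nonneg)
  have small: "c * (card I * \<eta>) \<le> \<delta>"
    using \<delta> c by (simp add: \<eta>_def divide_simps add_nonneg_eq_0_iff)
  let ?B = "\<lambda>\<epsilon> i. {\<omega>\<in>space M. \<bar>Y i \<epsilon> \<omega> - L i \<omega>\<bar> > \<eta>}"
  have "\<forall>\<^sub>F \<epsilon> in F. measure M {\<omega>\<in>space M. \<bar>Z \<epsilon> \<omega> - K \<omega>\<bar> > \<delta>} \<le> (\<Sum>i\<in>I. measure M (?B \<epsilon> i))"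
    using meas le
  proof eventually_elim
    case (elim \<epsilon>)
    have B: "?B \<epsilon> i \<in> sets M" if "i \<in> I" for i
    proof -
      have [measurable]: "(\<lambda>\<omega>. Y i \<epsilon> \<omega> - L i \<omega>) \<in> borel_measurable M" using elim(1) that by auto
      show ?thesis by measurable
    qed
    have "{\<omega>\<in>space M. \<bar>Z \<epsilon> \<omega> - K \<omega>\<bar> > \<delta>} \<subseteq> (\<Union>i\<in>I. ?B \<epsilon> i)"
    proof clarsimp
      fix \<omega> assume \<omega>: "\<omega> \<in> space M" "\<delta> < \<bar>Z \<epsilon> \<omega> - K \<omega>\<bar>"
      show "\<exists>i\<in>I. \<eta> < \<bar>Y i \<epsilon> \<omega> - L i \<omega>\<bar>"
      proof (rule ccontr)
        assume "\<not> ?thesis"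
        then have "(\<Sum>i\<in>I. \<bar>Y i \<epsilon> \<omega> - L i \<omega>\<bar>) \<le> card I * \<eta>"
          by (intro sum_bounded_above) (auto simp: not_less)
        then have "c * (\<Sum>i\<in>I. \<bar>Y i \<epsilon> \<omega> - L i \<omega>\<bar>) \<le> c * (card I * \<eta>)"
          using c by simp
        with elim(2) \<omega> small show False by fastforce
      qed
    qed
    then have "measure M {\<omega>\<in>space M. \<bar>Z \<epsilon> \<omega> - K \<omega>\<bar> > \<delta>} \<le> measure M (\<Union>i\<in>I. ?B \<epsilon> i)"
      using B I by (intro finite_measure_mono) auto
    also have "\<dots> \<le> (\<Sum>i\<in>I. measure M (?B \<epsilon> i))"
      using B I by (intro finite_measure_subadditive_finite) auto
    finally show ?case .
  qed
  moreover have "((\<lambda>\<epsilon>. \<Sum>i\<in>I. measure M (?B \<epsilon> i)) \<longlongrightarrow> 0) F"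
    using Y \<eta> by (intro tendsto_null_sum) (auto simp: converges_in_prob_def)
  ultimately show "((\<lambda>\<epsilon>. measure M {\<omega>\<in>space M. \<bar>Z \<epsilon> \<omega> - K \<omega>\<bar> > \<delta>}) \<longlongrightarrow> 0) F"
    by (rule tendsto_sandwich[OF _ _ tendsto_const, rotated]) auto
qed

lemma converges_in_prob_AE_cong:
  assumes "converges_in_prob M Y L F" "AE \<omega> in M. C \<omega> = L \<omega>"
    and "\<forall>\<^sub>F \<epsilon> in F. Y \<epsilon> \<in> borel_measurable M"
    and "L \<in> borel_measurable M" "C \<in> borel_measurable M"
  shows "converges_in_prob M Y C F"
  unfolding converges_in_prob_def
proof (intro allI impI)
  fix \<delta> :: real assume \<delta>: "\<delta> > 0"
  note [measurable] = assms(4,5)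
  have "\<forall>\<^sub>F \<epsilon> in F. measure M {\<omega>\<in>space M. \<bar>Y \<epsilon> \<omega> - L \<omega>\<bar> > \<delta>} = measure M {\<omega>\<in>space M. \<bar>Y \<epsilon> \<omega> - C \<omega>\<bar> > \<delta>}"
    using assms(3)
  proof eventually_elim
    case (elim \<epsilon>)
    note [measurable] = elim
    show ?case by (rule measure_eq_AE) (use assms(2) in auto)
  qed
  then show "((\<lambda>\<epsilon>. measure M {\<omega>\<in>space M. \<bar>Y \<epsilon> \<omega> - C \<omega>\<bar> > \<delta>}) \<longlongrightarrow> 0) F"
    using assms(1) \<delta> unfolding converges_in_prob_def by (auto intro: Lim_transform_eventually)
qed

text \<open>Where \<open>L < - 1/(n+1)\<close>, a nonnegative \<open>Y\<close> deviates from
  \<open>L\<close> by more than \<open>1/(n+1)\<close>, an event of vanishing probability.\<close>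

lemma converges_in_prob_nonneg:
  assumes "converges_in_prob M Y L F" "F \<noteq> bot" and M: "prob_space M"
    and Y: "\<forall>\<^sub>F \<epsilon> in F. Y \<epsilon> \<in> borel_measurable M \<and> (\<forall>\<omega>\<in>space M. 0 \<le> Y \<epsilon> \<omega>)"
    and [measurable]: "L \<in> borel_measurable M"
  shows "AE \<omega> in M. 0 \<le> L \<omega>"
proof -
  interpret prob_space M by fact
  have "AE \<omega> in M. \<not> L \<omega> < - (1 / Suc n)" for n
  proof -
    let ?N = "{\<omega>\<in>space M. L \<omega> < - (1 / Suc n)}"
    have ev: "\<forall>\<^sub>F \<epsilon> in F. measure M ?N \<le> measure M {\<omega>\<in>space M. \<bar>Y \<epsilon> \<omega> - L \<omega>\<bar> > 1 / Suc n}"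
      using Y
    proof eventually_elim
      case (elim \<epsilon>)
      then have [measurable]: "Y \<epsilon> \<in> borel_measurable M" by simp
      show ?case by (rule finite_measure_mono) (use elim in fastforce, measurable)
    qed
    have "((\<lambda>\<epsilon>. measure M {\<omega>\<in>space M. \<bar>Y \<epsilon> \<omega> - L \<omega>\<bar> > 1 / Suc n}) \<longlongrightarrow> 0) F"
      using assms(1) unfolding converges_in_prob_def by simp
    then have "measure M ?N \<le> 0"
      by (rule tendsto_lowerbound[OF _ ev assms(2)])
    then have "measure M ?N = 0" by (simp add: measure_le_0_iff)
    then show ?thesis by (subst AE_iff_measurable[OF _ refl]) (auto simp: emeasure_eq_measure)
  qed
  then have "AE \<omega> in M. \<forall>n. \<not> L \<omega> < - (1 / Suc n)" by (simp add: AE_all_countable)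
  then show ?thesis
  proof eventually_elim
    case (elim \<omega>)
    show ?case
    proof (rule ccontr)
      assume "\<not> 0 \<le> L \<omega>"
      then obtain n where "1 / Suc n < - L \<omega>" using nat_approx_posE[of "- L \<omega>"] by auto
      with elim[rule_format, of n] show False by linarith
    qed
  qed
qed

text \<open>Along a subsequence the events that \<open>Y\<close> is more than 1 away from the limit have
  summable probabilities, so by Borel-Cantelli almost surely only finitely many of them occur.\<close>

lemma converges_in_prob_bounded_subseq:
  fixes Y :: "real \<Rightarrow> 'w \<Rightarrow> real"
  assumes M: "prob_space M"
    and Y: "converges_in_prob M Y L (at_right 0)"
    and meas: "\<And>\<epsilon>. \<epsilon> > 0 \<Longrightarrow> Y \<epsilon> \<in> borel_measurable M"
    and [measurable]: "L \<in> borel_measurable M"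
    and e: "\<And>k. e k > 0" "e \<longlonglongrightarrow> 0"
  obtains r :: "nat \<Rightarrow> nat" where "strict_mono r" "AE \<omega> in M. \<exists>K. \<forall>k. \<bar>Y (e (r k)) \<omega>\<bar> \<le> K"
proof -
  interpret prob_space M by fact
  have [measurable]: "Y (e k) \<in> borel_measurable M" for k using meas e by auto
  let ?B = "\<lambda>k. {\<omega>\<in>space M. \<bar>Y (e k) \<omega> - L \<omega>\<bar> > 1}"
  have "filterlim e (at_right 0) sequentially"
    using e by (auto simp: filterlim_at intro!: always_eventually less_imp_neq[symmetric])
  moreover have "((\<lambda>\<epsilon>. measure M {\<omega>\<in>space M. \<bar>Y \<epsilon> \<omega> - L \<omega>\<bar> > 1}) \<longlongrightarrow> 0) (at_right 0)"
    using Y by (auto simp: converges_in_prob_def)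
  ultimately have lim: "(\<lambda>k. measure M (?B k)) \<longlonglongrightarrow> 0"
    by (rule filterlim_compose[rotated])
  \<comment> \<open>The bound \<open>(1/2) ^ n\<close> makes the probabilities summable along the subsequence built from these indices.\<close>
  have ex: "\<exists>k>N. measure M (?B k) < (1/2) ^ n" for n N :: nat
  proof -
    have "\<forall>\<^sub>F k in sequentially. measure M (?B k) < (1/2) ^ n \<and> N < k"
      using order_tendstoD(2)[OF lim, of "(1/2)^n"] eventually_gt_at_top[of N]
      by (auto elim: eventually_conj)
    then show ?thesis using eventually_happens'[OF sequentially_bot] by blast
  qed
  have "\<exists>r. \<forall>n. measure M (?B (r n)) < (1/2) ^ n \<and> r n < r (Suc n)"
    using ex[of _ 0] ex by (intro dependent_nat_choice) (blast, metis)
  then obtain r where r: "\<And>n. measure M (?B (r n)) < (1/2) ^ n" "\<And>n. r n < r (Suc n)" by blast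
  have "summable (\<lambda>n. measure M (?B (r n)))"
    by (rule summable_comparison_test'[OF summable_geometric[of "1/2::real"], of 0])
       (use r(1) in \<open>auto intro: less_imp_le\<close>)
  then have "AE \<omega> in M. \<forall>\<^sub>F n in sequentially. \<omega> \<in> space M - ?B (r n)"
    by (intro borel_cantelli_AE1) (auto simp: emeasure_eq_measure)
  then have "AE \<omega> in M. \<exists>K. \<forall>k. \<bar>Y (e (r k)) \<omega>\<bar> \<le> K"
  proof eventually_elim
    case (elim \<omega>)
    then have "\<forall>\<^sub>F n in sequentially. norm (Y (e (r n)) \<omega>) \<le> \<bar>L \<omega>\<bar> + 1"
      by eventually_elim (auto simp: not_less)
    then have "Bseq (\<lambda>n. Y (e (r n)) \<omega>)" by (rule BfunI)
    then show ?case by (auto simp: Bseq_def)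
  qed
  moreover have "strict_mono r" using r(2) by (simp add: strict_mono_Suc_iff)
  ultimately show thesis using that by blast
qed

section \<open>Convergence uniformly in time\<close>

lemma converges_in_prob_of_ucp:
  assumes M: "prob_space M" and "0 < T"
    and A: "\<forall>\<^sub>F \<epsilon> in F. continuous_process M T (A \<epsilon>)" and C: "continuous_process M T C"
    and "converges_ucp M T A C F" "t \<in> {0..T}"
  shows "converges_in_prob M (\<lambda>\<epsilon>. A \<epsilon> t) (C t) F"
proof (rule converges_in_prob_dominated[OF M, where I = "{()}" and c = 1
      and Y = "\<lambda>_ \<epsilon> \<omega>. SUP t\<in>{0..T}. \<bar>A \<epsilon> t \<omega> - C t \<omega>\<bar>" and L = "\<lambda>_ _. 0"])
  show "\<forall>\<^sub>F \<epsilon> in F. \<forall>i\<in>{()}. (\<lambda>\<omega>. (SUP t\<in>{0..T}. \<bar>A \<epsilon> t \<omega> - C t \<omega>\<bar>) - 0) \<in> borel_measurable M"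
    using A by eventually_elim (use assms in \<open>auto intro!: borel_measurable_sup_abs continuous_process_diff\<close>)
  show "\<forall>\<^sub>F \<epsilon> in F. \<forall>\<omega>\<in>space M. \<bar>A \<epsilon> t \<omega> - C t \<omega>\<bar>
      \<le> 1 * (\<Sum>i\<in>{()}. \<bar>(SUP t\<in>{0..T}. \<bar>A \<epsilon> t \<omega> - C t \<omega>\<bar>) - 0\<bar>)"
    using A
  proof eventually_elim
    case (elim \<epsilon>)
    have "\<bar>A \<epsilon> t \<omega> - C t \<omega>\<bar> \<le> (SUP t\<in>{0..T}. \<bar>A \<epsilon> t \<omega> - C t \<omega>\<bar>)" if "\<omega> \<in> space M" for \<omega>
      using continuous_process_diff[OF elim C] that assms(6)
      by (intro abs_le_sup_abs) (auto simp: continuous_process_def)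
    then show ?case by (auto intro: order_trans[OF _ abs_ge_self])
  qed
qed (use assms in \<open>auto simp: converges_ucp_def\<close>)

lemma converges_ucp_sum:
  fixes A :: "'i \<Rightarrow> real \<Rightarrow> real \<Rightarrow> 'w \<Rightarrow> real"
  assumes M: "prob_space M" and T: "0 < T" and I: "finite I"
    and A: "\<forall>\<^sub>F \<epsilon> in F. \<forall>i\<in>I. continuous_process M T (A i \<epsilon>)"
    and C: "\<And>i. i \<in> I \<Longrightarrow> continuous_process M T (C i)"
    and lim: "\<And>i. i \<in> I \<Longrightarrow> converges_ucp M T (A i) (C i) F"
    and Z: "\<forall>\<^sub>F \<epsilon> in F. \<forall>t\<in>{0..T}. \<forall>\<omega>\<in>space M. Z \<epsilon> t \<omega> = (\<Sum>i\<in>I. a i * A i \<epsilon> t \<omega>)"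
  shows "converges_ucp M T Z (\<lambda>t \<omega>. \<Sum>i\<in>I. a i * C i t \<omega>) F"
  unfolding converges_ucp_def
proof (rule converges_in_prob_dominated[OF M I, where c = "1 + (\<Sum>i\<in>I. \<bar>a i\<bar>)"
      and Y = "\<lambda>i \<epsilon> \<omega>. SUP t\<in>{0..T}. \<bar>A i \<epsilon> t \<omega> - C i t \<omega>\<bar>" and L = "\<lambda>_ _. 0"])
  show "converges_in_prob M (\<lambda>\<epsilon> \<omega>. SUP t\<in>{0..T}. \<bar>A i \<epsilon> t \<omega> - C i t \<omega>\<bar>) (\<lambda>\<omega>. 0) F" if "i \<in> I" for i
    using lim[OF that] by (simp add: converges_ucp_def)
  show "\<forall>\<^sub>F \<epsilon> in F. \<forall>i\<in>I. (\<lambda>\<omega>. (SUP t\<in>{0..T}. \<bar>A i \<epsilon> t \<omega> - C i t \<omega>\<bar>) - 0) \<in> borel_measurable M"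
    using A by eventually_elim (use T C in \<open>auto intro!: borel_measurable_sup_abs continuous_process_diff\<close>)
  show "0 < 1 + (\<Sum>i\<in>I. \<bar>a i\<bar>)" by (simp add: add_pos_nonneg sum_nonneg)
  show "\<forall>\<^sub>F \<epsilon> in F. \<forall>\<omega>\<in>space M.
      \<bar>(SUP t\<in>{0..T}. \<bar>Z \<epsilon> t \<omega> - (\<Sum>i\<in>I. a i * C i t \<omega>)\<bar>) - 0\<bar>
      \<le> (1 + (\<Sum>i\<in>I. \<bar>a i\<bar>)) * (\<Sum>i\<in>I. \<bar>(SUP t\<in>{0..T}. \<bar>A i \<epsilon> t \<omega> - C i t \<omega>\<bar>) - 0\<bar>)"
    using A Z
  proof eventually_elim
    case (elim \<epsilon>)
    show ?case
    proof
      fix \<omega> assume \<omega>: "\<omega> \<in> space M"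
      define S where "S i = (SUP t\<in>{0..T}. \<bar>A i \<epsilon> t \<omega> - C i t \<omega>\<bar>)" for i
      have le_S: "\<bar>A i \<epsilon> t \<omega> - C i t \<omega>\<bar> \<le> S i" if "i \<in> I" "t \<in> {0..T}" for i t
        unfolding S_def using elim(1) C[OF that(1)] that \<omega>
        by (intro abs_le_sup_abs) (auto simp: continuous_process_def intro!: continuous_intros)
      have S0: "0 \<le> S i" if "i \<in> I" for i
        using le_S[OF that, of 0] T by auto
      have bound: "\<bar>Z \<epsilon> t \<omega> - (\<Sum>i\<in>I. a i * C i t \<omega>)\<bar> \<le> (1 + (\<Sum>i\<in>I. \<bar>a i\<bar>)) * (\<Sum>i\<in>I. S i)"
        if t: "t \<in> {0..T}" for t
      proof -
        have "Z \<epsilon> t \<omega> - (\<Sum>i\<in>I. a i * C i t \<omega>) = (\<Sum>i\<in>I. a i * (A i \<epsilon> t \<omega> - C i t \<omega>))"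
          using elim(2) t \<omega> by (simp add: sum_subtractf right_diff_distrib)
        also have "\<bar>\<dots>\<bar> \<le> (\<Sum>i\<in>I. \<bar>a i * (A i \<epsilon> t \<omega> - C i t \<omega>)\<bar>)" by (rule sum_abs)
        also have "\<dots> \<le> (\<Sum>i\<in>I. (1 + (\<Sum>i\<in>I. \<bar>a i\<bar>)) * S i)"
        proof (rule sum_mono)
          fix i assume i: "i \<in> I"
          have "\<bar>a i\<bar> \<le> (\<Sum>i\<in>I. \<bar>a i\<bar>)" using i I by (intro member_le_sum) auto
          then show "\<bar>a i * (A i \<epsilon> t \<omega> - C i t \<omega>)\<bar> \<le> (1 + (\<Sum>i\<in>I. \<bar>a i\<bar>)) * S i"
            using le_S[OF i t] S0[OF i] by (auto simp: abs_mult intro!: mult_mono)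
        qed
        finally show ?thesis by (simp add: sum_distrib_left)
      qed
      have "(SUP t\<in>{0..T}. \<bar>Z \<epsilon> t \<omega> - (\<Sum>i\<in>I. a i * C i t \<omega>)\<bar>)
          \<le> (1 + (\<Sum>i\<in>I. \<bar>a i\<bar>)) * (\<Sum>i\<in>I. S i)"
        using T bound by (intro cSUP_least) auto
      moreover have "0 \<le> (SUP t\<in>{0..T}. \<bar>Z \<epsilon> t \<omega> - (\<Sum>i\<in>I. a i * C i t \<omega>)\<bar>)"
        using T bound by (intro cSUP_upper2[where x = 0] bdd_aboveI2) auto
      ultimately show "\<bar>(SUP t\<in>{0..T}. \<bar>Z \<epsilon> t \<omega> - (\<Sum>i\<in>I. a i * C i t \<omega>)\<bar>) - 0\<bar>
          \<le> (1 + (\<Sum>i\<in>I. \<bar>a i\<bar>)) * (\<Sum>i\<in>I. \<bar>(SUP t\<in>{0..T}. \<bar>A i \<epsilon> t \<omega> - C i t \<omega>\<bar>) - 0\<bar>)"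
        using S0 unfolding S_def[symmetric] by simp
    qed
  qed
qed

section \<open>Limits of nondecreasing processes\<close>

text \<open>Between two neighbouring grid points \<open>l \<le> t \<le> u\<close> the monotone function is
  squeezed: \<open>a l \<le> a t \<le> a u\<close>, and \<open>a l\<close>, \<open>a u\<close>
  are close to \<open>c l\<close>, \<open>c u\<close>, which are close to \<open>c t\<close>.\<close>

lemma mono_close_of_grid:
  fixes a c :: "real \<Rightarrow> real"
  assumes "mono_on {0..T} a" "t \<in> {0..T}" "0 < T"
    and grid: "\<And>i. i \<le> Suc n \<Longrightarrow> \<bar>a (real i * T / Suc n) - c (real i * T / Suc n)\<bar> \<le> \<delta>"
    and osc: "\<And>u v. u \<in> {0..T} \<Longrightarrow> v \<in> {0..T} \<Longrightarrow> \<bar>u - v\<bar> \<le> T / Suc n \<Longrightarrow> \<bar>c u - c v\<bar> \<le> \<eta>"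
  shows "\<bar>a t - c t\<bar> \<le> \<delta> + \<eta>"
proof (cases "t = T")
  case True
  then show ?thesis using grid[of "Suc n"] osc[of T T] assms(3) by fastforce
next
  case False
  \<comment> \<open>The index of the grid cell that contains \<open>t\<close>; for \<open>t = T\<close> it would be the nonexistent cell to the right of \<open>T\<close>.\<close>
  define i where "i = nat \<lfloor>t * Suc n / T\<rfloor>"
  have nn: "0 \<le> t * Suc n / T" using assms by simp
  have i1: "real i \<le> t * Suc n / T" "t * Suc n / T < real i + 1"
    unfolding i_def using nn by auto
  have "t * Suc n / T < Suc n" using False assms by (simp add: field_simps del: of_nat_Suc)
  then have "real i < Suc n" using i1(1) by linarith
  then have i2: "i < Suc n" by linarith
  define l u where "l = real i * T / Suc n" and "u = real (Suc i) * T / Suc n"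
  have "l \<le> t" using i1(1) assms(3) by (simp add: l_def field_simps)
  moreover have "t \<le> u" using i1(2) assms(3) by (simp add: u_def field_simps)
  moreover have "0 \<le> l" using assms(3) by (simp add: l_def)
  moreover have "u \<le> T"
  proof -
    have "real (Suc i) * T \<le> real (Suc n) * T" using i2 assms(3) by (intro mult_right_mono) auto
    then show ?thesis by (simp add: u_def field_simps)
  qed
  moreover have "u - l = T / Suc n" by (simp add: u_def l_def algebra_simps flip: diff_divide_distrib)
  ultimately have "\<bar>c l - c t\<bar> \<le> \<eta>" "\<bar>c u - c t\<bar> \<le> \<eta>" "a l \<le> a t" "a t \<le> a u"
    using assms by (auto intro!: osc monotone_onD[OF assms(1)])
  moreover have "\<bar>a l - c l\<bar> \<le> \<delta>" "\<bar>a u - c u\<bar> \<le> \<delta>"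
    unfolding l_def u_def using i2 by (auto intro!: grid simp del: of_nat_Suc)
  ultimately show ?thesis by linarith
qed

text \<open>The events \<open>B \<eta> n\<close> that \<open>C\<close> oscillates by more than
  \<open>\<eta>\<close> over some distance at most \<open>T/(n+1)\<close> decrease with
  \<open>n\<close>, and their intersection is empty because each path is uniformly continuous.
  Measurability rests on the density argument in \<open>sets_ex_gt\<close>, applied to pairs of
  times.\<close>

lemma oscillation_prob_tendsto_0:
  fixes C :: "real \<Rightarrow> 'w \<Rightarrow> real"
  assumes M: "prob_space M" and C: "continuous_process M T C"
  defines "B \<equiv> \<lambda>\<eta> n. {\<omega>\<in>space M. \<exists>p\<in>{p \<in> {0..T} \<times> {0..T}. \<bar>fst p - snd p\<bar> \<le> T / Suc n}.
                        \<eta> < \<bar>C (fst p) \<omega> - C (snd p) \<omega>\<bar>}"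
  assumes "0 < \<eta>" "0 < T"
  shows "B \<eta> n \<in> sets M" "(\<lambda>n. measure M (B \<eta> n)) \<longlonglongrightarrow> 0"
proof -
  interpret prob_space M by fact
  have cont: "continuous_on {0..T} (\<lambda>t. C t \<omega>)" if "\<omega> \<in> space M" for \<omega>
    using C that by (auto simp: continuous_process_def)
  show B: "B \<eta> n \<in> sets M" for n
    unfolding B_def
  proof (rule sets_ex_gt)
    fix \<omega> assume \<omega>: "\<omega> \<in> space M"
    show "continuous_on {p \<in> {0..T} \<times> {0..T}. \<bar>fst p - snd p\<bar> \<le> T / Suc n} (\<lambda>p. \<bar>C (fst p) \<omega> - C (snd p) \<omega>\<bar>)"
      by (intro continuous_intros continuous_on_compose2[OF cont[OF \<omega>]]) auto
  next
    fix p assume p: "p \<in> {p \<in> {0..T} \<times> {0..T}. \<bar>fst p - snd p\<bar> \<le> T / Suc n}"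
    have [measurable]: "C (fst p) \<in> borel_measurable M" "C (snd p) \<in> borel_measurable M"
      using p C by (auto simp: continuous_process_def)
    show "(\<lambda>\<omega>. \<bar>C (fst p) \<omega> - C (snd p) \<omega>\<bar>) \<in> borel_measurable M" by measurable
  qed
  have dec: "decseq (B \<eta>)"
    unfolding decseq_def
  proof (intro allI impI)
    fix m n :: nat assume "m \<le> n"
    then have "T / Suc n \<le> T / Suc m" using \<open>0 < T\<close> by (intro divide_left_mono) auto
    then have "{p \<in> {0..T} \<times> {0..T}. \<bar>fst p - snd p\<bar> \<le> T / Suc n}
        \<subseteq> {p \<in> {0..T} \<times> {0..T}. \<bar>fst p - snd p\<bar> \<le> T / Suc m}" by auto
    then show "B \<eta> n \<subseteq> B \<eta> m" unfolding B_def by blast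
  qed
  have "\<exists>n. \<omega> \<notin> B \<eta> n" if \<omega>: "\<omega> \<in> space M" for \<omega>
  proof -
    have "uniformly_continuous_on {0..T} (\<lambda>t. C t \<omega>)"
      using cont[OF \<omega>] by (intro compact_uniformly_continuous) auto
    then obtain d where d: "d > 0"
      "\<And>s t. s \<in> {0..T} \<Longrightarrow> t \<in> {0..T} \<Longrightarrow> \<bar>s - t\<bar> < d \<Longrightarrow> \<bar>C s \<omega> - C t \<omega>\<bar> < \<eta>"
      using \<open>0 < \<eta>\<close> unfolding uniformly_continuous_on_def dist_real_def by metis
    obtain n where n: "1 / Suc n < d / T" using d(1) assms nat_approx_posE[of "d / T"] by auto
    then have "T / Suc n < d" using assms by (simp add: field_simps)
    have "\<not> \<eta> < \<bar>C (fst p) \<omega> - C (snd p) \<omega>\<bar>"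
      if "p \<in> {0..T} \<times> {0..T}" "\<bar>fst p - snd p\<bar> \<le> T / Suc n" for p
      using d(2)[of "fst p" "snd p"] that \<open>T / Suc n < d\<close> by (auto simp: mem_Times_iff)
    then have "\<omega> \<notin> B \<eta> n" unfolding B_def by blast
    then show ?thesis ..
  qed
  moreover have "B \<eta> n \<subseteq> space M" for n by (auto simp: B_def)
  ultimately have "(\<Inter>n. B \<eta> n) = {}" by blast
  then show "(\<lambda>n. measure M (B \<eta> n)) \<longlonglongrightarrow> 0"
    using finite_Lim_measure_decseq[OF _ dec] B by (simp add: image_subset_iff)
qed

text \<open>By \<open>mono_close_of_grid\<close> a large uniform deviation forces either a large oscillation
  of the limit, which is improbable for a fine grid, or a large deviation at one of the finitely
  many points of that grid, which is improbable for \<open>\<epsilon>\<close> far enough along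
  \<open>F\<close>. The grid has to be chosen before \<open>\<epsilon>\<close>.\<close>

lemma monotone_pointwise_imp_ucp:
  assumes M: "prob_space M" and T: "0 < T" and C: "continuous_process M T C"
    and A: "\<forall>\<^sub>F \<epsilon> in F. continuous_process M T (A \<epsilon>)"
    and mono: "\<forall>\<^sub>F \<epsilon> in F. \<forall>\<omega>\<in>space M. mono_on {0..T} (\<lambda>t. A \<epsilon> t \<omega>)"
    and lim: "\<And>t. t \<in> {0..T} \<Longrightarrow> converges_in_prob M (\<lambda>\<epsilon>. A \<epsilon> t) (C t) F"
  shows "converges_ucp M T A C F"
  unfolding converges_ucp_def converges_in_prob_def
proof (intro allI impI)
  interpret prob_space M by fact
  fix \<delta> :: real assume \<delta>: "\<delta> > 0"
  define B where "B n = {\<omega>\<in>space M. \<exists>p\<in>{p \<in> {0..T} \<times> {0..T}. \<bar>fst p - snd p\<bar> \<le> T / Suc n}.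
                        \<delta> / 2 < \<bar>C (fst p) \<omega> - C (snd p) \<omega>\<bar>}" for n
  have B: "B n \<in> sets M" and B_lim: "(\<lambda>n. measure M (B n)) \<longlonglongrightarrow> 0" for n
    using oscillation_prob_tendsto_0[OF M C, of "\<delta> / 2"] \<delta> T unfolding B_def by auto
  let ?S = "\<lambda>\<epsilon>. {\<omega>\<in>space M. \<bar>(SUP t\<in>{0..T}. \<bar>A \<epsilon> t \<omega> - C t \<omega>\<bar>) - 0\<bar> > \<delta>}"
  let ?G = "\<lambda>\<epsilon> t. {\<omega>\<in>space M. \<bar>A \<epsilon> t \<omega> - C t \<omega>\<bar> > \<delta> / 2}"
  show "((\<lambda>\<epsilon>. measure M (?S \<epsilon>)) \<longlongrightarrow> 0) F"
  proof (rule tendstoI)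
    fix e :: real assume e: "e > 0"
    \<comment> \<open>Half of the tolerance goes to the oscillation of the limit, half to the grid points.\<close>
    obtain n where n: "measure M (B n) < e / 2"
      using order_tendstoD(2)[OF B_lim, of "e / 2"] e by (auto simp: eventually_sequentially)
    let ?g = "\<lambda>i. real i * T / Suc n"
    have g: "?g i \<in> {0..T}" if "i \<le> Suc n" for i
    proof -
      have "real i * T \<le> real (Suc n) * T" using that T by (intro mult_right_mono) auto
      then show ?thesis using T by (simp add: field_simps)
    qed
    have "((\<lambda>\<epsilon>. \<Sum>i\<le>Suc n. measure M (?G \<epsilon> (?g i))) \<longlongrightarrow> 0) F"
    proof (rule tendsto_null_sum)
      fix i assume "i \<in> {..Suc n}"
      then have "converges_in_prob M (\<lambda>\<epsilon>. A \<epsilon> (?g i)) (C (?g i)) F" by (intro lim g) simp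
      then show "((\<lambda>\<epsilon>. measure M (?G \<epsilon> (?g i))) \<longlongrightarrow> 0) F"
        unfolding converges_in_prob_def using \<delta> half_gt_zero by blast
    qed
    then have "\<forall>\<^sub>F \<epsilon> in F. (\<Sum>i\<le>Suc n. measure M (?G \<epsilon> (?g i))) < e / 2"
      using e by (intro order_tendstoD(2)) auto
    then show "\<forall>\<^sub>F \<epsilon> in F. dist (measure M (?S \<epsilon>)) 0 < e"
      using A mono
    proof eventually_elim
      case (elim \<epsilon>)
      have AC: "continuous_process M T (\<lambda>t \<omega>. A \<epsilon> t \<omega> - C t \<omega>)"
        by (rule continuous_process_diff[OF elim(2) C])
      have G: "?G \<epsilon> t \<in> sets M" if "t \<in> {0..T}" for t
      proof -
        have [measurable]: "(\<lambda>\<omega>. A \<epsilon> t \<omega> - C t \<omega>) \<in> borel_measurable M"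
          using that AC by (auto simp: continuous_process_def)
        show ?thesis by measurable
      qed
      then have UG: "(\<Union>i\<le>Suc n. ?G \<epsilon> (?g i)) \<in> sets M"
        using g by (intro sets.finite_UN) (auto simp del: of_nat_Suc)
      have "?S \<epsilon> \<subseteq> (\<Union>i\<le>Suc n. ?G \<epsilon> (?g i)) \<union> B n"
      proof (rule subsetI, rule ccontr)
        fix \<omega> assume \<omega>: "\<omega> \<in> ?S \<epsilon>" "\<omega> \<notin> (\<Union>i\<le>Suc n. ?G \<epsilon> (?g i)) \<union> B n"
        have sp: "\<omega> \<in> space M" using \<omega>(1) by simp
        have cont: "continuous_on {0..T} (\<lambda>t. A \<epsilon> t \<omega> - C t \<omega>)"
          using AC sp by (auto simp: continuous_process_def)
        have "\<bar>A \<epsilon> t \<omega> - C t \<omega>\<bar> \<le> \<delta> / 2 + \<delta> / 2" if "t \<in> {0..T}" for t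
        proof (rule mono_close_of_grid[OF _ that T, where n = n])
          show "mono_on {0..T} (\<lambda>t. A \<epsilon> t \<omega>)" using elim(3) sp by auto
          show "\<bar>A \<epsilon> (?g i) \<omega> - C (?g i) \<omega>\<bar> \<le> \<delta> / 2" if "i \<le> Suc n" for i
            using \<omega>(2) sp that by (auto simp: not_less simp del: of_nat_Suc)
          show "\<bar>C u \<omega> - C v \<omega>\<bar> \<le> \<delta> / 2" if "u \<in> {0..T}" "v \<in> {0..T}" "\<bar>u - v\<bar> \<le> T / Suc n" for u v
          proof (rule ccontr)
            assume "\<not> ?thesis"
            then have "\<exists>p\<in>{p \<in> {0..T} \<times> {0..T}. \<bar>fst p - snd p\<bar> \<le> T / Suc n}.
                \<delta> / 2 < \<bar>C (fst p) \<omega> - C (snd p) \<omega>\<bar>"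
              using that by (intro bexI[of _ "(u, v)"]) (auto simp: not_le)
            then show False using \<omega>(2) sp unfolding B_def by blast
          qed
        qed
        then have "\<not> \<delta> < (SUP t\<in>{0..T}. \<bar>A \<epsilon> t \<omega> - C t \<omega>\<bar>)"
          using sup_abs_gt_iff[OF cont, of \<delta>] T by (simp add: not_less)
        moreover have "0 \<le> (SUP t\<in>{0..T}. \<bar>A \<epsilon> t \<omega> - C t \<omega>\<bar>)"
          by (rule order_trans[OF abs_ge_zero abs_le_sup_abs[OF cont, of 0]]) (use T in auto)
        ultimately show False using \<omega>(1) by simp
      qed
      then have "measure M (?S \<epsilon>) \<le> measure M ((\<Union>i\<le>Suc n. ?G \<epsilon> (?g i)) \<union> B n)"
        using UG B by (intro finite_measure_mono) auto
      also have "\<dots> \<le> measure M (\<Union>i\<le>Suc n. ?G \<epsilon> (?g i)) + measure M (B n)"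
        using UG B by (rule measure_Un_le)
      also have "measure M (\<Union>i\<le>Suc n. ?G \<epsilon> (?g i)) \<le> (\<Sum>i\<le>Suc n. measure M (?G \<epsilon> (?g i)))"
        using G g by (intro finite_measure_subadditive_finite) (auto simp del: of_nat_Suc)
      finally show ?case using elim(1) n by simp
    qed
  qed
qed

text \<open>For fixed \<open>s \<le> t\<close> the order \<open>C s \<le> C t\<close> holds almost surely as
  a limit of nonnegative increments. Continuity reduces all pairs of times to countably many, so
  one null set suffices.\<close>

lemma AE_mono_limit:
  fixes C :: "real \<Rightarrow> 'w \<Rightarrow> real"
  assumes M: "prob_space M" and F: "F \<noteq> bot" and C: "continuous_process M T C"
    and A: "\<forall>\<^sub>F \<epsilon> in F. continuous_process M T (A \<epsilon>)"
    and mono: "\<forall>\<^sub>F \<epsilon> in F. \<forall>\<omega>\<in>space M. mono_on {0..T} (\<lambda>t. A \<epsilon> t \<omega>)"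
    and lim: "\<And>t. t \<in> {0..T} \<Longrightarrow> converges_in_prob M (\<lambda>\<epsilon>. A \<epsilon> t) (C t) F"
  shows "AE \<omega> in M. mono_on {0..T} (\<lambda>t. C t \<omega>)"
proof -
  have le: "AE \<omega> in M. C s \<omega> \<le> C t \<omega>" if st: "s \<in> {0..T}" "t \<in> {0..T}" "s \<le> t" for s t
  proof -
    have "converges_in_prob M (\<lambda>\<epsilon> \<omega>. A \<epsilon> t \<omega> - A \<epsilon> s \<omega>) (\<lambda>\<omega>. C t \<omega> - C s \<omega>) F"
    proof (rule converges_in_prob_dominated[OF M, where I = "{s, t}" and Y = "\<lambda>t \<epsilon>. A \<epsilon> t" and L = C and c = 2])
      show "\<forall>\<^sub>F \<epsilon> in F. \<forall>i\<in>{s, t}. (\<lambda>\<omega>. A \<epsilon> i \<omega> - C i \<omega>) \<in> borel_measurable M"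
        using A by eventually_elim
          (use C st in \<open>auto simp: continuous_process_def intro!: borel_measurable_diff\<close>)
      show "\<forall>\<^sub>F \<epsilon> in F. \<forall>\<omega>\<in>space M. \<bar>A \<epsilon> t \<omega> - A \<epsilon> s \<omega> - (C t \<omega> - C s \<omega>)\<bar>
          \<le> 2 * (\<Sum>i\<in>{s, t}. \<bar>A \<epsilon> i \<omega> - C i \<omega>\<bar>)"
      proof (intro always_eventually allI ballI)
        fix \<epsilon> \<omega>
        have "\<bar>A \<epsilon> i \<omega> - C i \<omega>\<bar> \<le> (\<Sum>i\<in>{s, t}. \<bar>A \<epsilon> i \<omega> - C i \<omega>\<bar>)" if "i \<in> {s, t}" for i
          using that by (intro member_le_sum) auto
        from this[of s, OF insertI1] this[of t, OF insertI2[OF insertI1]]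
        show "\<bar>A \<epsilon> t \<omega> - A \<epsilon> s \<omega> - (C t \<omega> - C s \<omega>)\<bar>
            \<le> 2 * (\<Sum>i\<in>{s, t}. \<bar>A \<epsilon> i \<omega> - C i \<omega>\<bar>)"
          by linarith
      qed
    qed (use st lim in auto)
    then have "AE \<omega> in M. 0 \<le> C t \<omega> - C s \<omega>"
    proof (rule converges_in_prob_nonneg[OF _ F M])
      show "\<forall>\<^sub>F \<epsilon> in F. (\<lambda>\<omega>. A \<epsilon> t \<omega> - A \<epsilon> s \<omega>) \<in> borel_measurable M
          \<and> (\<forall>\<omega>\<in>space M. 0 \<le> A \<epsilon> t \<omega> - A \<epsilon> s \<omega>)"
        using A mono
      proof eventually_elim
        case (elim \<epsilon>)
        have "A \<epsilon> s \<omega> \<le> A \<epsilon> t \<omega>" if "\<omega> \<in> space M" for \<omega>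
          using monotone_onD[OF elim(2)[rule_format, OF that] st] .
        then show ?case
          using elim(1) st by (auto simp: continuous_process_def intro!: borel_measurable_diff)
      qed
    qed (use C st in \<open>auto simp: continuous_process_def intro!: borel_measurable_diff\<close>)
    then show ?thesis by simp
  qed
  \<comment> \<open>The pairs of times that have to be compared form a closed triangle; a countable dense subset of it is enough.\<close>
  define S where "S = {p \<in> {0..T} \<times> {0..T}. fst p \<le> snd p}"
  obtain D where D: "countable D" "D \<subseteq> S" "S \<subseteq> closure D"
    using separable by blast
  have "AE \<omega> in M. \<forall>p\<in>D. C (fst p) \<omega> \<le> C (snd p) \<omega>"
    using D le by (subst AE_ball_countable) (auto simp: S_def)
  then show ?thesis
    using AE_space
  proof eventually_elim
    case (elim \<omega>)
    have cont: "continuous_on {0..T} (\<lambda>t. C t \<omega>)" using C elim(2) by (auto simp: continuous_process_def)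
    have "continuous_on S (\<lambda>p. C (fst p) \<omega> - C (snd p) \<omega>)"
      unfolding S_def by (intro continuous_intros continuous_on_compose2[OF cont]) auto
    from ex_gt_dense_iff[OF this D(2,3), of 0] elim(1)
    have le_S: "\<forall>p\<in>S. C (fst p) \<omega> \<le> C (snd p) \<omega>" by (meson diff_gt_0_iff_gt not_less)
    show ?case
    proof (rule monotone_onI)
      fix s t assume "s \<in> {0..T}" "t \<in> {0..T}" "s \<le> t"
      then show "C s \<omega> \<le> C t \<omega>" using le_S[rule_format, of "(s, t)"] by (simp add: S_def)
    qed
  qed
qed

section \<open>Paths of bounded variation\<close>

lemma bounded_variation_mono:
  fixes f :: "real \<Rightarrow> real"
  assumes "mono_on {0..T} f"
  shows "bounded_variation T f"
  unfolding bounded_variation_def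
proof (intro exI allI impI)
  fix m :: nat and p :: "nat \<Rightarrow> real"
  assume p: "(\<forall>i\<le>m. p i \<in> {0..T}) \<and> (\<forall>i<m. p i \<le> p (Suc i))"
  have "(\<Sum>i<m. norm (f (p (Suc i)) - f (p i))) = (\<Sum>i<m. f (p (Suc i)) - f (p i))"
    using p by (intro sum.cong refl) (simp add: monotone_onD[OF assms])
  also have "\<dots> = f (p m) - f (p 0)" by (rule sum_lessThan_telescope)
  also have "\<dots> \<le> f T - f 0"
    using p[THEN conjunct1, rule_format, of m] p[THEN conjunct1, rule_format, of 0]
    by (intro diff_mono monotone_onD[OF assms]) auto
  finally show "(\<Sum>i<m. norm (f (p (Suc i)) - f (p i))) \<le> f T - f 0" .
qed

lemma bounded_variation_sum:
  fixes f :: "'i \<Rightarrow> real \<Rightarrow> real" and v :: "'i \<Rightarrow> 'b::real_normed_vector"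
  assumes "finite I" "\<And>i. i \<in> I \<Longrightarrow> bounded_variation T (f i)"
  shows "bounded_variation T (\<lambda>t. \<Sum>i\<in>I. f i t *\<^sub>R v i)"
proof -
  obtain K where K: "\<And>i m p. i \<in> I \<Longrightarrow> \<forall>j\<le>m. p j \<in> {0..T} \<Longrightarrow> \<forall>j<m. p j \<le> p (Suc j)
      \<Longrightarrow> (\<Sum>j<m. norm (f i (p (Suc j)) - f i (p j))) \<le> K i"
    using assms(2) unfolding bounded_variation_def by metis
  show ?thesis
    unfolding bounded_variation_def
  proof (intro exI allI impI)
    fix m :: nat and p :: "nat \<Rightarrow> real"
    assume p: "(\<forall>i\<le>m. p i \<in> {0..T}) \<and> (\<forall>i<m. p i \<le> p (Suc i))"
    have "(\<Sum>j<m. norm ((\<Sum>i\<in>I. f i (p (Suc j)) *\<^sub>R v i) - (\<Sum>i\<in>I. f i (p j) *\<^sub>R v i)))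
        \<le> (\<Sum>j<m. \<Sum>i\<in>I. norm (f i (p (Suc j)) - f i (p j)) * norm (v i))"
    proof (rule sum_mono)
      fix j
      have "(\<Sum>i\<in>I. f i (p (Suc j)) *\<^sub>R v i) - (\<Sum>i\<in>I. f i (p j) *\<^sub>R v i)
          = (\<Sum>i\<in>I. (f i (p (Suc j)) - f i (p j)) *\<^sub>R v i)"
        by (simp add: sum_subtractf scaleR_left_diff_distrib)
      also have "norm \<dots> \<le> (\<Sum>i\<in>I. norm ((f i (p (Suc j)) - f i (p j)) *\<^sub>R v i))" by (rule norm_sum)
      finally show "norm ((\<Sum>i\<in>I. f i (p (Suc j)) *\<^sub>R v i) - (\<Sum>i\<in>I. f i (p j) *\<^sub>R v i))
          \<le> (\<Sum>i\<in>I. norm (f i (p (Suc j)) - f i (p j)) * norm (v i))" by simp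
    qed
    also have "\<dots> = (\<Sum>i\<in>I. (\<Sum>j<m. norm (f i (p (Suc j)) - f i (p j))) * norm (v i))"
      by (subst sum.swap) (simp add: sum_distrib_right)
    also have "\<dots> \<le> (\<Sum>i\<in>I. K i * norm (v i))"
      using K p by (intro sum_mono mult_right_mono) auto
    finally show "(\<Sum>j<m. norm ((\<Sum>i\<in>I. f i (p (Suc j)) *\<^sub>R v i) - (\<Sum>i\<in>I. f i (p j) *\<^sub>R v i)))
        \<le> (\<Sum>i\<in>I. K i * norm (v i))" .
  qed
qed

lemma cadlag_continuous:
  assumes "continuous_on {0..T} f"
  shows "cadlag T f"
  unfolding cadlag_def
proof (intro conjI ballI)
  fix t assume "t \<in> {0..<T}"
  then show "(f \<longlongrightarrow> f t) (at_right t)"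
    by (intro continuous_on_Icc_at_rightD[where b = T] continuous_on_subset[OF assms]) auto
next
  fix t assume "t \<in> {0<..T}"
  then have "(f \<longlongrightarrow> f t) (at_left t)"
    by (intro continuous_on_Icc_at_leftD[where a = 0] continuous_on_subset[OF assms]) auto
  then show "\<exists>l. (f \<longlongrightarrow> l) (at_left t)" ..
qed

section \<open>Approximations of the covariation of two real processes\<close>

lemma continuous_increment:
  fixes X :: "real \<Rightarrow> 'w \<Rightarrow> real"
  assumes "continuous_process M T X" "\<omega> \<in> space M" "0 \<le> T"
  shows "continuous_on S (\<lambda>s. increment T X \<epsilon> s \<omega>)"
proof -
  have "continuous_on S (\<lambda>s. extend T X (s + d) \<omega>)" for d
    by (rule continuous_on_compose2[OF continuous_extend[OF assms]]) (auto intro!: continuous_intros)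
  from continuous_on_diff[OF this[of \<epsilon>] this[of 0]]
  show ?thesis by (simp add: increment_def)
qed

lemma integrable_increment_product:
  fixes X Y :: "real \<Rightarrow> 'w \<Rightarrow> real"
  assumes "continuous_process M T X" "continuous_process M T Y" "\<omega> \<in> space M" "0 \<le> T"
  shows "set_integrable lborel {a..b} (\<lambda>s. increment T X \<epsilon> s \<omega> * increment T Y \<epsilon> s \<omega>)"
  by (intro borel_integrable_atLeastAtMost' continuous_on_mult
      continuous_increment[OF assms(1,3,4)] continuous_increment[OF assms(2-4)])

lemma measurable_increment_pair:
  fixes X :: "real \<Rightarrow> 'w \<Rightarrow> real"
  assumes "continuous_process M T X" "0 \<le> T"
  shows "(\<lambda>(\<omega>, s). increment T X \<epsilon> s \<omega>) \<in> borel_measurable (M \<Otimes>\<^sub>M lborel)"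
proof -
  have "(\<lambda>p. extend T X (snd p + d) (fst p)) \<in> borel_measurable (M \<Otimes>\<^sub>M lborel)" for d
    using measurable_compose[of "\<lambda>p. (fst p, snd p + d)", OF _ measurable_extend_pair[OF assms]]
    by simp
  from borel_measurable_diff[OF this[of \<epsilon>] this[of 0]]
  show ?thesis by (simp add: increment_def case_prod_beta)
qed

lemma continuous_process_covariation_approx:
  assumes "continuous_process M T X" "continuous_process M T Y" "0 \<le> T"
  shows "continuous_process M T (covariation_approx T X Y \<epsilon>)"
  unfolding continuous_process_def
proof (intro conjI ballI)
  fix t
  have "(\<lambda>(\<omega>, s). indicat_real {0..t} s *\<^sub>R (increment T X \<epsilon> s \<omega> * increment T Y \<epsilon> s \<omega>))
      \<in> borel_measurable (M \<Otimes>\<^sub>M lborel)"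
    using measurable_increment_pair[OF assms(1,3), of \<epsilon>] measurable_increment_pair[OF assms(2,3), of \<epsilon>]
    by (simp add: case_prod_beta)
  from lborel.borel_measurable_lebesgue_integral[OF this]
  show "covariation_approx T X Y \<epsilon> t \<in> borel_measurable M"
    unfolding covariation_approx_def[abs_def] set_lebesgue_integral_def by simp
next
  fix \<omega> assume "\<omega> \<in> space M"
  then have "continuous_on UNIV (\<lambda>t. LINT s:{0..t}|lborel. increment T X \<epsilon> s \<omega> * increment T Y \<epsilon> s \<omega>)"
    using assms by (intro continuous_on_LBINT integrable_increment_product)
  then have "continuous_on UNIV (\<lambda>t. covariation_approx T X Y \<epsilon> t \<omega>)"
    unfolding covariation_approx_def by (intro continuous_on_mult continuous_on_const)
  then show "continuous_on {0..T} (\<lambda>t. covariation_approx T X Y \<epsilon> t \<omega>)"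
    by (rule continuous_on_subset) simp
qed

lemma mono_covariation_approx:
  assumes "continuous_process M T X" "\<omega> \<in> space M" "0 \<le> T" "0 < \<epsilon>"
  shows "mono_on {0..T} (\<lambda>t. covariation_approx T X X \<epsilon> t \<omega>)"
proof (rule monotone_onI)
  fix s t :: real assume "s \<le> t"
  have "(LINT s:{0..s}|lborel. increment T X \<epsilon> s \<omega> * increment T X \<epsilon> s \<omega>)
      \<le> (LINT s:{0..t}|lborel. increment T X \<epsilon> s \<omega> * increment T X \<epsilon> s \<omega>)"
    unfolding set_lebesgue_integral_def
    using integrable_increment_product[OF assms(1,1,2,3)] \<open>s \<le> t\<close>
    by (intro integral_mono) (auto simp: set_integrable_def split: split_indicator)
  then show "covariation_approx T X X \<epsilon> s \<omega> \<le> covariation_approx T X X \<epsilon> t \<omega>"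
    using assms(4) by (simp add: covariation_approx_def divide_right_mono)
qed

lemma integral_sum_increment_products:
  fixes U V :: "'i \<Rightarrow> real \<Rightarrow> 'w \<Rightarrow> real" and a :: "'i \<Rightarrow> real" and \<epsilon> t :: real
  assumes "finite I" "\<And>i. i \<in> I \<Longrightarrow> continuous_process M T (U i)"
    "\<And>i. i \<in> I \<Longrightarrow> continuous_process M T (V i)" "\<omega> \<in> space M" "0 \<le> T"
  defines "f \<equiv> \<lambda>s. \<Sum>i\<in>I. a i * (increment T (U i) \<epsilon> s \<omega> * increment T (V i) \<epsilon> s \<omega>)"
  shows "set_integrable lborel {0..t} f"
    and "1 / \<epsilon> * (LINT s:{0..t}|lborel. f s) = (\<Sum>i\<in>I. a i * covariation_approx T (U i) (V i) \<epsilon> t \<omega>)"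
proof -
  have int: "set_integrable lborel {0..t} (\<lambda>s. a i * (increment T (U i) \<epsilon> s \<omega> * increment T (V i) \<epsilon> s \<omega>))"
    if "i \<in> I" for i
    using assms that by (intro set_integrable_mult_right integrable_increment_product) auto
  show "set_integrable lborel {0..t} f"
    using int unfolding f_def set_integrable_def by (simp add: sum_distrib_left)
  have "(LINT s:{0..t}|lborel. f s)
      = (\<Sum>i\<in>I. LINT s:{0..t}|lborel. a i * (increment T (U i) \<epsilon> s \<omega> * increment T (V i) \<epsilon> s \<omega>))"
    using int unfolding f_def set_lebesgue_integral_def set_integrable_def
    by (simp add: sum_distrib_left Bochner_Integration.integral_sum)
  then show "1 / \<epsilon> * (LINT s:{0..t}|lborel. f s) = (\<Sum>i\<in>I. a i * covariation_approx T (U i) (V i) \<epsilon> t \<omega>)"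
    by (simp add: covariation_approx_def sum_divide_distrib)
qed

lemma covariation_approx_polarization:
  assumes X: "continuous_process M T X" and Y: "continuous_process M T Y"
    and \<omega>: "\<omega> \<in> space M" and T: "0 \<le> T"
  shows "covariation_approx T (\<lambda>t \<omega>. X t \<omega> + Y t \<omega>) (\<lambda>t \<omega>. X t \<omega> + Y t \<omega>) \<epsilon> t \<omega>
    = covariation_approx T X X \<epsilon> t \<omega> + 2 * covariation_approx T X Y \<epsilon> t \<omega> + covariation_approx T Y Y \<epsilon> t \<omega>"
proof -
  let ?x = "\<lambda>s. increment T X \<epsilon> s \<omega>" and ?y = "\<lambda>s. increment T Y \<epsilon> s \<omega>"
  note int = integrable_increment_product[OF X X \<omega> T] integrable_increment_product[OF Y Y \<omega> T]
    set_integrable_mult_right[OF integrable_increment_product[OF X Y \<omega> T], where a = 2]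
  have "(LINT s:{0..t}|lborel. increment T (\<lambda>t \<omega>. X t \<omega> + Y t \<omega>) \<epsilon> s \<omega> * increment T (\<lambda>t \<omega>. X t \<omega> + Y t \<omega>) \<epsilon> s \<omega>)
      = (LINT s:{0..t}|lborel. ?x s * ?x s + 2 * (?x s * ?y s) + ?y s * ?y s)"
    by (simp add: increment_def extend_def algebra_simps)
  also have "\<dots> = (LINT s:{0..t}|lborel. ?x s * ?x s) + 2 * (LINT s:{0..t}|lborel. ?x s * ?y s)
      + (LINT s:{0..t}|lborel. ?y s * ?y s)"
    by (subst set_integral_add(2) | intro set_integral_add(1) int | simp)+
  finally show ?thesis
    by (simp add: covariation_approx_def add_divide_distrib)
qed

text \<open>The limit in probability may be replaced by its continuous version, since at each time the two
  agree almost surely.\<close>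

lemma covariation_existsD:
  assumes "covariation_exists M T X Y" "0 \<le> T"
    and XY: "continuous_process M T X" "continuous_process M T Y"
  obtains C where "continuous_process M T C"
    "\<And>t. t \<in> {0..T} \<Longrightarrow> converges_in_prob M (\<lambda>\<epsilon>. covariation_approx T X Y \<epsilon> t) (C t) (at_right 0)"
proof -
  obtain L C where L: "\<forall>t\<in>{0..T}. L t \<in> borel_measurable M \<and>
             converges_in_prob M (\<lambda>\<epsilon>. covariation_approx T X Y \<epsilon> t) (L t) (at_right 0)"
    and C: "continuous_process M T C" "\<forall>t\<in>{0..T}. AE \<omega> in M. C t \<omega> = L t \<omega>"
    using assms(1) unfolding covariation_exists_def by blast
  have "converges_in_prob M (\<lambda>\<epsilon>. covariation_approx T X Y \<epsilon> t) (C t) (at_right 0)" if "t \<in> {0..T}" for t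
  proof (rule converges_in_prob_AE_cong)
    show "converges_in_prob M (\<lambda>\<epsilon>. covariation_approx T X Y \<epsilon> t) (L t) (at_right 0)"
      "AE \<omega> in M. C t \<omega> = L t \<omega>" "L t \<in> borel_measurable M" "C t \<in> borel_measurable M"
      using L C that by (simp_all add: continuous_process_def)
    show "\<forall>\<^sub>F \<epsilon> in at_right 0. covariation_approx T X Y \<epsilon> t \<in> borel_measurable M"
      using continuous_process_covariation_approx[OF XY assms(2)] that
      by (intro always_eventually) (simp add: continuous_process_def)
  qed
  with C(1) show thesis using that by blast
qed

text \<open>The polarization step: the approximations for \<open>X + Y\<close>, \<open>X\<close> and
  \<open>Y\<close> are nondecreasing in time and converge to \<open>cXX + 2 cXY + cYY\<close>,
  \<open>cXX\<close> and \<open>cYY\<close>, and \<open>cXY\<close> is a linear combination of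
  these three.\<close>

lemma covariation_limit:
  assumes M: "prob_space M" and T: "0 < T"
    and X: "continuous_process M T X" and Y: "continuous_process M T Y"
    and cXX: "continuous_process M T cXX" and cXY: "continuous_process M T cXY"
    and cYY: "continuous_process M T cYY"
    and limXX: "\<And>t. t \<in> {0..T} \<Longrightarrow> converges_in_prob M (\<lambda>\<epsilon>. covariation_approx T X X \<epsilon> t) (cXX t) (at_right 0)"
    and limXY: "\<And>t. t \<in> {0..T} \<Longrightarrow> converges_in_prob M (\<lambda>\<epsilon>. covariation_approx T X Y \<epsilon> t) (cXY t) (at_right 0)"
    and limYY: "\<And>t. t \<in> {0..T} \<Longrightarrow> converges_in_prob M (\<lambda>\<epsilon>. covariation_approx T Y Y \<epsilon> t) (cYY t) (at_right 0)"
  shows "converges_ucp M T (covariation_approx T X Y) cXY (at_right 0)"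
    and "AE \<omega> in M. bounded_variation T (\<lambda>t. cXY t \<omega>)"
proof -
  \<comment> \<open>Three nondecreasing processes, their limits and their weights in the polarization identity; index 0 stands for the sum \<open>X + Y\<close>.\<close>
  define Z where "Z = (\<lambda>i::nat. if i = 0 then (\<lambda>t \<omega>. X t \<omega> + Y t \<omega>) else if i = 1 then X else Y)"
  define c where "c = (\<lambda>i::nat. if i = 0 then (\<lambda>t \<omega>. cXX t \<omega> + 2 * cXY t \<omega> + cYY t \<omega>)
      else if i = 1 then cXX else cYY)"
  define a where "a = (\<lambda>i::nat. if i = 0 then 1 / 2 else - 1 / 2 :: real)"
  let ?I = "{0, 1, 2::nat}"
  let ?A = "\<lambda>i. covariation_approx T (Z i) (Z i)"
  have Z: "continuous_process M T (Z i)" for i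
    using X Y continuous_process_comb[OF X Y, of 1 1] by (simp add: Z_def)
  have c: "continuous_process M T (c i)" for i
    using cXX cYY continuous_process_comb[OF continuous_process_comb[OF cXX cXY, of 1 2] cYY, of 1 1]
    by (simp add: c_def)
  have A: "continuous_process M T (?A i \<epsilon>)" for i \<epsilon>
    using Z T by (intro continuous_process_covariation_approx) auto
  have meas: "(\<lambda>\<omega>. covariation_approx T U V \<epsilon> t \<omega> - cUV t \<omega>) \<in> borel_measurable M"
    if "continuous_process M T U" "continuous_process M T V" "continuous_process M T cUV" "t \<in> {0..T}"
    for U V cUV \<epsilon> t
    using continuous_process_diff[OF continuous_process_covariation_approx[OF that(1,2)] that(3)] T that(4)
    by (auto simp: continuous_process_def)
  have lim0: "converges_in_prob M (\<lambda>\<epsilon>. ?A 0 \<epsilon> t) (c 0 t) (at_right 0)" if t: "t \<in> {0..T}" for t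
  proof (rule converges_in_prob_dominated[OF M, where I = ?I and c = 2
        and Y = "\<lambda>i \<epsilon>. covariation_approx T (if i = 2 then Y else X) (if i = 0 then X else Y) \<epsilon> t"
        and L = "\<lambda>i. if i = 0 then cXX t else if i = 1 then cXY t else cYY t"])
    show "converges_in_prob M (\<lambda>\<epsilon>. covariation_approx T (if i = 2 then Y else X) (if i = 0 then X else Y) \<epsilon> t)
        (if i = 0 then cXX t else if i = 1 then cXY t else cYY t) (at_right 0)" if "i \<in> ?I" for i
      using that limXX[OF t] limXY[OF t] limYY[OF t] by auto
    show "\<forall>\<^sub>F \<epsilon> in at_right 0. \<forall>i\<in>?I. (\<lambda>\<omega>. covariation_approx T (if i = 2 then Y else X) (if i = 0 then X else Y) \<epsilon> t \<omega>
        - (if i = 0 then cXX t else if i = 1 then cXY t else cYY t) \<omega>) \<in> borel_measurable M"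
      using meas[OF X X cXX t] meas[OF X Y cXY t] meas[OF Y Y cYY t] by (intro always_eventually) auto
    show "\<forall>\<^sub>F \<epsilon> in at_right 0. \<forall>\<omega>\<in>space M. \<bar>?A 0 \<epsilon> t \<omega> - c 0 t \<omega>\<bar>
      \<le> 2 * (\<Sum>i\<in>?I. \<bar>covariation_approx T (if i = 2 then Y else X) (if i = 0 then X else Y) \<epsilon> t \<omega>
        - (if i = 0 then cXX t else if i = 1 then cXY t else cYY t) \<omega>\<bar>)"
    proof (intro always_eventually allI ballI)
      fix \<epsilon> \<omega> assume \<omega>: "\<omega> \<in> space M"
      show "\<bar>?A 0 \<epsilon> t \<omega> - c 0 t \<omega>\<bar>
        \<le> 2 * (\<Sum>i\<in>?I. \<bar>covariation_approx T (if i = 2 then Y else X) (if i = 0 then X else Y) \<epsilon> t \<omega>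
          - (if i = 0 then cXX t else if i = 1 then cXY t else cYY t) \<omega>\<bar>)"
        using covariation_approx_polarization[OF X Y \<omega>, of \<epsilon> t] T
        by (simp add: Z_def c_def) (smt (verit))
    qed
  qed auto
  have lim: "converges_in_prob M (\<lambda>\<epsilon>. ?A i \<epsilon> t) (c i t) (at_right 0)" if "t \<in> {0..T}" for i t
  proof (cases "i = 0")
    case False
    then show ?thesis using limXX[OF that] limYY[OF that] by (simp add: Z_def c_def)
  qed (use lim0[OF that] in simp)
  have mono: "\<forall>\<^sub>F \<epsilon> in at_right 0. \<forall>\<omega>\<in>space M. mono_on {0..T} (\<lambda>t. ?A i \<epsilon> t \<omega>)" for i
    using eventually_at_right_less[of "0 :: real"]
  proof eventually_elim
    case (elim \<epsilon>)
    show ?case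
    proof
      fix \<omega> assume "\<omega> \<in> space M"
      then show "mono_on {0..T} (\<lambda>t. ?A i \<epsilon> t \<omega>)"
        by (rule mono_covariation_approx[OF Z _ less_imp_le[OF T] elim])
    qed
  qed
  have ucp: "converges_ucp M T (?A i) (c i) (at_right 0)" for i
    by (rule monotone_pointwise_imp_ucp[OF M T c always_eventually[OF allI, OF A] mono lim])
  have sum_c: "(\<Sum>i\<in>?I. a i * c i t \<omega>) = cXY t \<omega>" for t \<omega>
    by (simp add: a_def c_def add_divide_distrib)
  have "converges_ucp M T (covariation_approx T X Y) (\<lambda>t \<omega>. \<Sum>i\<in>?I. a i * c i t \<omega>) (at_right 0)"
  proof (rule converges_ucp_sum[OF M T, where A = ?A])
    show "\<forall>\<^sub>F \<epsilon> in at_right 0. \<forall>t\<in>{0..T}. \<forall>\<omega>\<in>space M.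
        covariation_approx T X Y \<epsilon> t \<omega> = (\<Sum>i\<in>?I. a i * ?A i \<epsilon> t \<omega>)"
    proof (intro always_eventually allI ballI)
      fix \<epsilon> t \<omega> assume \<omega>: "\<omega> \<in> space M"
      show "covariation_approx T X Y \<epsilon> t \<omega> = (\<Sum>i\<in>?I. a i * ?A i \<epsilon> t \<omega>)"
        using covariation_approx_polarization[OF X Y \<omega>, of \<epsilon> t] T
        by (simp add: a_def Z_def add_divide_distrib)
    qed
    show "\<forall>\<^sub>F \<epsilon> in at_right 0. \<forall>i\<in>?I. continuous_process M T (?A i \<epsilon>)"
      using A by (intro always_eventually) blast
  qed (use c ucp in simp_all)
  then show "converges_ucp M T (covariation_approx T X Y) cXY (at_right 0)"
    by (simp only: sum_c)
  have "AE \<omega> in M. mono_on {0..T} (\<lambda>t. c i t \<omega>)" for i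
    by (rule AE_mono_limit[OF M _ c always_eventually[OF allI, OF A] mono lim]) simp
  then have "AE \<omega> in M. \<forall>i. mono_on {0..T} (\<lambda>t. c i t \<omega>)" by (simp add: AE_all_countable)
  then show "AE \<omega> in M. bounded_variation T (\<lambda>t. cXY t \<omega>)"
  proof eventually_elim
    case (elim \<omega>)
    have "bounded_variation T (\<lambda>t. \<Sum>i\<in>?I. c i t \<omega> *\<^sub>R a i)"
      using elim by (intro bounded_variation_sum bounded_variation_mono) auto
    then show ?case by (simp only: real_scaleR_def mult.commute[of _ "a _"] sum_c)
  qed
qed

section \<open>Bilinear forms on a finite-dimensional space\<close>

lemma tensor_apply: "blinfun_apply (tensor x y) \<phi> = blinfun_apply (blinfun_apply \<phi> x) y"
  by transfer simp

lemma norm_tensor_le: "norm (tensor x y) \<le> norm x * norm y"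
proof (rule norm_blinfun_bound)
  fix \<phi> :: "'a chi"
  have "norm (blinfun_apply (blinfun_apply \<phi> x) y) \<le> norm (blinfun_apply \<phi> x) * norm y"
    by (rule norm_blinfun)
  also have "\<dots> \<le> (norm \<phi> * norm x) * norm y"
    by (intro mult_right_mono norm_blinfun) auto
  finally show "norm (blinfun_apply (tensor x y) \<phi>) \<le> norm x * norm y * norm \<phi>"
    by (simp add: tensor_apply ac_simps)
qed simp

text \<open>The matrix entry \<open>\<phi>\<^sub>i\<^sub>j\<close>, indexed by the pair \<open>k = (i, j)\<close> so that double sums become single
  sums over one finite type.\<close>

definition chi_coeff :: "(real ^ 'n) chi \<Rightarrow> 'n \<times> 'n \<Rightarrow> real" where
  "chi_coeff \<phi> k = blinfun_apply (blinfun_apply \<phi> (axis (fst k) 1)) (axis (snd k) 1)"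

lemma chi_expansion:
  fixes \<phi> :: "(real ^ 'n) chi"
  shows "blinfun_apply (blinfun_apply \<phi> x) y = (\<Sum>k\<in>UNIV. chi_coeff \<phi> k * (x $ fst k * y $ snd k))"
proof -
  have ex: "z = (\<Sum>i\<in>UNIV. z $ i *\<^sub>R axis i 1)" for z :: "real ^ 'n"
    using basis_expansion[of z] by (simp add: scalar_mult_eq_scaleR)
  have "blinfun_apply (blinfun_apply \<phi> x) y
      = blinfun_apply (blinfun_apply \<phi> (\<Sum>i\<in>UNIV. x $ i *\<^sub>R axis i 1)) (\<Sum>j\<in>UNIV. y $ j *\<^sub>R axis j 1)"
    by (subst (1 2) ex) (rule refl)
  also have "\<dots> = (\<Sum>i\<in>UNIV. \<Sum>j\<in>UNIV. chi_coeff \<phi> (i, j) * (x $ i * y $ j))"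
    by (simp add: blinfun.sum_left blinfun.sum_right blinfun.scaleR_left blinfun.scaleR_right
        chi_coeff_def sum_distrib_left ac_simps)
       (rule sum.swap)
  finally show ?thesis
    by (simp add: sum.cartesian_product case_prod_beta flip: UNIV_Times_UNIV)
qed

lemma coordinate_form_exists:
  fixes i j :: "'n::finite"
  obtains \<phi> :: "(real ^ 'n) chi" where "\<And>x y. blinfun_apply (blinfun_apply \<phi> x) y = x $ i * y $ j"
proof -
  have "bounded_linear (\<lambda>x :: real ^ 'n. (x $ i) *\<^sub>R blinfun_inner_right (axis j 1 :: real ^ 'n))"
    by (intro bounded_linear_compose[OF bounded_linear_scaleR_left bounded_linear_vec_nth])
  then have "blinfun_apply (blinfun_apply (Blinfun (\<lambda>x :: real ^ 'n. (x $ i) *\<^sub>R blinfun_inner_right (axis j 1))) x) y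
      = x $ i * y $ j" for x y :: "real ^ 'n"
    by (simp add: bounded_linear_Blinfun_apply blinfun.scaleR_left inner_axis' )
  then show thesis using that by blast
qed

section \<open>Components of a vector-valued process\<close>

lemma increment_vec_nth: "increment T X \<epsilon> s \<omega> $ i = increment T (\<lambda>t \<omega>. X t \<omega> $ i) \<epsilon> s \<omega>"
  by (simp add: increment_def extend_def)

lemma continuous_process_vec_nth:
  fixes X :: "real \<Rightarrow> 'w \<Rightarrow> real ^ 'n"
  assumes "continuous_process M T X"
  shows "continuous_process M T (\<lambda>t \<omega>. X t \<omega> $ i)"
  unfolding continuous_process_def
proof (intro conjI ballI)
  fix t assume "t \<in> {0..T}"
  then have "X t \<in> borel_measurable M" using assms by (simp add: continuous_process_def)
  from measurable_compose[OF this borel_measurable_continuous_onI[OF continuous_on_component[OF continuous_on_id]]]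
  show "(\<lambda>\<omega>. X t \<omega> $ i) \<in> borel_measurable M" .
next
  fix \<omega> assume "\<omega> \<in> space M"
  then show "continuous_on {0..T} (\<lambda>t. X t \<omega> $ i)"
    using assms by (intro continuous_on_component) (simp add: continuous_process_def)
qed

lemma integral_scaled_increment_tensor:
  fixes X :: "real \<Rightarrow> 'w \<Rightarrow> real ^ 'n"
  assumes X: "continuous_process M T X" and "\<omega> \<in> space M" "0 \<le> T"
  shows "(LINT s:{0..t}|lborel. blinfun_apply (scaled_increment_tensor T X \<epsilon> s \<omega>) \<phi>)
    = (\<Sum>k\<in>UNIV. chi_coeff \<phi> k *
        covariation_approx T (\<lambda>t \<omega>. X t \<omega> $ fst k) (\<lambda>t \<omega>. X t \<omega> $ snd k) \<epsilon> t \<omega>)"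
proof -
  have "(LINT s:{0..t}|lborel. blinfun_apply (scaled_increment_tensor T X \<epsilon> s \<omega>) \<phi>)
      = 1 / \<epsilon> * (LINT s:{0..t}|lborel. \<Sum>k\<in>UNIV. chi_coeff \<phi> k *
          (increment T (\<lambda>t \<omega>. X t \<omega> $ fst k) \<epsilon> s \<omega> * increment T (\<lambda>t \<omega>. X t \<omega> $ snd k) \<epsilon> s \<omega>))"
    by (simp add: scaled_increment_tensor_def blinfun.scaleR_left tensor_apply chi_expansion increment_vec_nth)
  also have "\<dots> = (\<Sum>k\<in>UNIV. chi_coeff \<phi> k *
        covariation_approx T (\<lambda>t \<omega>. X t \<omega> $ fst k) (\<lambda>t \<omega>. X t \<omega> $ snd k) \<epsilon> t \<omega>)"
    using assms by (intro integral_sum_increment_products(2) continuous_process_vec_nth) auto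
  finally show ?thesis .
qed

text \<open>The norm of \<open>x \<otimes> x\<close> is at most \<open>norm x ^ 2 = \<Sum>\<^sub>i
  x\<^sub>i\<^sup>2\<close>, which, divided by \<open>\<epsilon>\<close> and integrated, is the
  sum of the approximations for the components.\<close>

lemma nn_integral_tensor_le:
  fixes X :: "real \<Rightarrow> 'w \<Rightarrow> real ^ 'n"
  assumes X: "continuous_process M T X" and \<omega>: "\<omega> \<in> space M" and T: "0 \<le> T" and \<epsilon>: "0 < \<epsilon>"
  shows "(\<integral>\<^sup>+ s\<in>{0..T}. ennreal (norm (tensor (increment T X \<epsilon> s \<omega>) (increment T X \<epsilon> s \<omega>)) / \<epsilon>) \<partial>lborel)
    \<le> ennreal (\<Sum>i\<in>UNIV. covariation_approx T (\<lambda>t \<omega>. X t \<omega> $ i) (\<lambda>t \<omega>. X t \<omega> $ i) \<epsilon> T \<omega>)"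
proof -
  let ?x = "\<lambda>i. increment T (\<lambda>t \<omega>. X t \<omega> $ i) \<epsilon>"
  define f where "f s = (\<Sum>i\<in>UNIV. 1 * (?x i s \<omega> * ?x i s \<omega>))" for s
  have f_int: "set_integrable lborel {0..T} f"
    and f_eq: "1 / \<epsilon> * (LINT s:{0..T}|lborel. f s)
      = (\<Sum>i\<in>UNIV. 1 * covariation_approx T (\<lambda>t \<omega>. X t \<omega> $ i) (\<lambda>t \<omega>. X t \<omega> $ i) \<epsilon> T \<omega>)"
    unfolding f_def using assms
    by (intro integral_sum_increment_products continuous_process_vec_nth finite; simp)+
  have f0: "0 \<le> f s" for s unfolding f_def by (simp add: sum_nonneg)
  have le: "norm (tensor (increment T X \<epsilon> s \<omega>) (increment T X \<epsilon> s \<omega>)) \<le> f s" for s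
  proof -
    have "norm (increment T X \<epsilon> s \<omega>) * norm (increment T X \<epsilon> s \<omega>) = increment T X \<epsilon> s \<omega> \<bullet> increment T X \<epsilon> s \<omega>"
      by (simp add: dot_square_norm power2_eq_square)
    also have "\<dots> = f s" by (simp add: inner_vec_def f_def increment_vec_nth)
    finally show ?thesis using norm_tensor_le by metis
  qed
  have "(\<integral>\<^sup>+ s\<in>{0..T}. ennreal (norm (tensor (increment T X \<epsilon> s \<omega>) (increment T X \<epsilon> s \<omega>)) / \<epsilon>) \<partial>lborel)
      \<le> (\<integral>\<^sup>+ s. ennreal (1 / \<epsilon> * (indicator {0..T} s *\<^sub>R f s)) \<partial>lborel)"
    using le \<epsilon> by (intro nn_integral_mono) (auto intro!: ennreal_leI divide_right_mono split: split_indicator)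
  also have "\<dots> = ennreal (1 / \<epsilon> * (LINT s:{0..T}|lborel. f s))"
    using f_int f0 \<epsilon> unfolding set_integrable_def set_lebesgue_integral_def
    by (subst nn_integral_eq_integral) auto
  finally show ?thesis unfolding f_eq by simp
qed

lemma measurable_process_pair:
  fixes C :: "real \<Rightarrow> 'w \<Rightarrow> real"
  assumes "continuous_process M T C" "0 \<le> T"
  shows "(\<lambda>(\<omega>, t). C t \<omega>) \<in> borel_measurable (M \<Otimes>\<^sub>M restrict_space borel {0..T})"
proof -
  have "snd \<in> measurable (M \<Otimes>\<^sub>M restrict_space borel {0..T}) (borel :: real measure)"
    by (rule measurable_compose[OF measurable_snd]) (rule measurable_restrict_space1, simp)
  from measurable_compose[OF measurable_Pair[OF measurable_fst this] measurable_extend_pair[OF assms]]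
  have "(\<lambda>p. extend T C (snd p) (fst p)) \<in> borel_measurable (M \<Otimes>\<^sub>M restrict_space borel {0..T})"
    by simp
  then show ?thesis
    by (rule measurable_cong[THEN iffD1, rotated])
       (auto simp: space_pair_measure space_restrict_space extend_def)
qed

text \<open>The sum is a continuous function of the coefficient vector. Going through \<open>real ^
  'i\<close> avoids sums of measurable functions with values in \<open>'b\<close>, whose
  measurability would need a countable base of \<open>'b\<close>.\<close>

lemma measurable_sum_scaleR:
  fixes f :: "'i::finite \<Rightarrow> 'a \<Rightarrow> real" and v :: "'i \<Rightarrow> 'b::real_normed_vector"
  assumes "\<And>i. f i \<in> borel_measurable N"
  shows "(\<lambda>x. \<Sum>i\<in>UNIV. f i x *\<^sub>R v i) \<in> borel_measurable N"
proof -
  have "(\<lambda>x. \<chi> i. f i x) \<in> borel_measurable N"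
    unfolding borel_measurable_euclidean_space[of "\<lambda>x. \<chi> i. f i x"]
    using assms by (auto simp: Basis_vec_def inner_axis)
  moreover have "continuous_on UNIV (\<lambda>z :: real ^ 'i. \<Sum>i\<in>UNIV. z $ i *\<^sub>R v i)"
    by (intro continuous_intros)
  ultimately have "(\<lambda>x. (\<lambda>z :: real ^ 'i. \<Sum>i\<in>UNIV. z $ i *\<^sub>R v i) (\<chi> i. f i x)) \<in> borel_measurable N"
    by (rule measurable_compose[OF _ borel_measurable_continuous_onI])
  then show ?thesis by simp
qed

section \<open>From mutual brackets to the global quadratic variation\<close>

text \<open>The sum of the diagonal approximations at the final time \<open>T\<close> dominates the
  integrals in \<open>H1\<close>, and as a family that converges in probability it is almost
  surely bounded along a subsequence.\<close>

lemma H1_of_brackets: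
  fixes X :: "real \<Rightarrow> 'w \<Rightarrow> real ^ 'n"
  assumes M: "prob_space M" and T: "0 < T" and X: "continuous_process M T X"
    and C: "\<And>i. continuous_process M T (C i)"
    and lim: "\<And>i. converges_in_prob M
      (\<lambda>\<epsilon>. covariation_approx T (\<lambda>t \<omega>. X t \<omega> $ i) (\<lambda>t \<omega>. X t \<omega> $ i) \<epsilon> T) (C i T) (at_right 0)"
  shows "H1 M T X"
  unfolding H1_def
proof (intro allI impI)
  fix e :: "nat \<Rightarrow> real" assume e: "(\<forall>k. e k > 0) \<and> decseq e \<and> e \<longlonglongrightarrow> 0"
  let ?A = "\<lambda>i \<epsilon>. covariation_approx T (\<lambda>t \<omega>. X t \<omega> $ i) (\<lambda>t \<omega>. X t \<omega> $ i) \<epsilon> T"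
  have A: "?A i \<epsilon> \<in> borel_measurable M" for i \<epsilon>
    using continuous_process_covariation_approx[OF continuous_process_vec_nth[OF X] continuous_process_vec_nth[OF X]] T
    by (simp add: continuous_process_def)
  have CT: "C i T \<in> borel_measurable M" for i
    using C T by (simp add: continuous_process_def)
  have "converges_in_prob M (\<lambda>\<epsilon> \<omega>. \<Sum>i\<in>UNIV. ?A i \<epsilon> \<omega>) (\<lambda>\<omega>. \<Sum>i\<in>UNIV. C i T \<omega>) (at_right 0)"
  proof (rule converges_in_prob_dominated[OF M finite lim, where c = 1])
    show "\<forall>\<^sub>F \<epsilon> in at_right 0. \<forall>i\<in>UNIV. (\<lambda>\<omega>. ?A i \<epsilon> \<omega> - C i T \<omega>) \<in> borel_measurable M"
      by (intro always_eventually allI ballI borel_measurable_diff A CT)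
    show "\<forall>\<^sub>F \<epsilon> in at_right 0. \<forall>\<omega>\<in>space M.
        \<bar>(\<Sum>i\<in>UNIV. ?A i \<epsilon> \<omega>) - (\<Sum>i\<in>UNIV. C i T \<omega>)\<bar> \<le> 1 * (\<Sum>i\<in>UNIV. \<bar>?A i \<epsilon> \<omega> - C i T \<omega>\<bar>)"
      by (intro always_eventually allI ballI) (simp add: sum_abs flip: sum_subtractf)
  qed simp
  then obtain r :: "nat \<Rightarrow> nat" where r: "strict_mono r"
    and bdd: "AE \<omega> in M. \<exists>K. \<forall>k. \<bar>\<Sum>i\<in>UNIV. ?A i (e (r k)) \<omega>\<bar> \<le> K"
    by (rule converges_in_prob_bounded_subseq[OF M, where e = e])
       (use e A CT in \<open>auto intro!: borel_measurable_sum\<close>)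
  show "\<exists>r :: nat \<Rightarrow> nat. strict_mono r \<and>
           (AE \<omega> in M. (SUP k. \<integral>\<^sup>+ s\<in>{0..T}.
              ennreal (norm (tensor (increment T X (e (r k)) s \<omega>) (increment T X (e (r k)) s \<omega>))
                / e (r k)) \<partial>lborel) < \<infinity>)"
  proof (intro exI conjI, rule r)
    show "AE \<omega> in M. (SUP k. \<integral>\<^sup>+ s\<in>{0..T}.
              ennreal (norm (tensor (increment T X (e (r k)) s \<omega>) (increment T X (e (r k)) s \<omega>))
                / e (r k)) \<partial>lborel) < \<infinity>"
      using bdd AE_space
    proof eventually_elim
      case (elim \<omega>)
      then obtain K where K: "\<And>k. \<bar>\<Sum>i\<in>UNIV. ?A i (e (r k)) \<omega>\<bar> \<le> K" by blast
      have "(SUP k. \<integral>\<^sup>+ s\<in>{0..T}.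
              ennreal (norm (tensor (increment T X (e (r k)) s \<omega>) (increment T X (e (r k)) s \<omega>))
                / e (r k)) \<partial>lborel) \<le> ennreal K"
      proof (rule SUP_least)
        fix k
        have "(\<Sum>i\<in>UNIV. ?A i (e (r k)) \<omega>) \<le> K" using K[of k] by linarith
        with nn_integral_tensor_le[OF X elim(2) less_imp_le[OF T], of "e (r k)"] e
        show "(\<integral>\<^sup>+ s\<in>{0..T}.
              ennreal (norm (tensor (increment T X (e (r k)) s \<omega>) (increment T X (e (r k)) s \<omega>))
                / e (r k)) \<partial>lborel) \<le> ennreal K"
          by (meson ennreal_leI order_trans)
      qed
      then show ?case by (simp add: le_less_trans[OF _ ennreal_less_top])
    qed
  qed
qed

text \<open>The tensor-valued process is \<open>\<Sum>\<^sub>i\<^sub>j C\<^sup>i\<^sup>j e\<^sub>i \<otimes>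
  e\<^sub>j\<close>; pairing it with \<open>\<phi>\<close> reproduces the coordinates of
  \<open>\<phi>\<close> as weights.\<close>

lemma H2ii_of_brackets:
  fixes C :: "'n::finite \<times> 'n \<Rightarrow> real \<Rightarrow> 'w \<Rightarrow> real"
  assumes "0 \<le> T" and C: "\<And>k. continuous_process M T (C k)"
    and bv: "\<And>k. AE \<omega> in M. bounded_variation T (\<lambda>t. C k t \<omega>)"
  shows "H2ii M T (\<lambda>(\<phi> :: (real ^ 'n) chi) t \<omega>. \<Sum>k\<in>UNIV. chi_coeff \<phi> k * C k t \<omega>)"
proof -
  define e :: "'n \<times> 'n \<Rightarrow> (real ^ 'n) chi_dual" where "e k = tensor (axis (fst k) 1) (axis (snd k) 1)" for k
  define Qt where "Qt \<omega> t = (\<Sum>k\<in>UNIV. C k t \<omega> *\<^sub>R e k)" for \<omega> t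
  have "(\<lambda>(\<omega>, t). Qt \<omega> t) \<in> borel_measurable (M \<Otimes>\<^sub>M restrict_space borel {0..T})"
    using measurable_sum_scaleR[OF measurable_process_pair[OF C assms(1)], where v = e]
    by (simp add: Qt_def case_prod_beta)
  moreover have "AE \<omega> in M. cadlag T (Qt \<omega>) \<and> bounded_variation T (Qt \<omega>)"
  proof -
    have "AE \<omega> in M. \<forall>k\<in>UNIV. bounded_variation T (\<lambda>t. C k t \<omega>)"
      by (rule AE_finite_allI[OF finite bv])
    then show ?thesis
      using AE_space
    proof eventually_elim
      case (elim \<omega>)
      have "continuous_on {0..T} (Qt \<omega>)"
        unfolding Qt_def[abs_def] using C elim(2)
        by (intro continuous_on_sum continuous_on_scaleR continuous_on_const) (auto simp: continuous_process_def)
      moreover have "bounded_variation T (Qt \<omega>)"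
        unfolding Qt_def[abs_def] using elim(1) by (intro bounded_variation_sum) auto
      ultimately show ?case by (simp add: cadlag_continuous)
    qed
  qed
  moreover have "blinfun_apply (Qt \<omega> t) \<phi> = (\<Sum>k\<in>UNIV. chi_coeff \<phi> k * C k t \<omega>)" for \<omega> t \<phi>
    by (simp add: Qt_def e_def blinfun.sum_left blinfun.scaleR_left tensor_apply chi_coeff_def mult.commute)
  ultimately show ?thesis
    unfolding H2ii_def by (intro exI[of _ Qt]) auto
qed

section \<open>The equivalence\<close>

theorem corollary3p28:
  fixes M :: "'w measure" and T :: real and X :: "real \<Rightarrow> 'w \<Rightarrow> real ^ 'n"
  assumes "prob_space M"
    and "0 < T"
    and "continuous_process M T X"
  shows "admits_all_mutual_brackets M T X \<longleftrightarrow> admits_global_quadratic_variation M T X"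
proof -
  note M = assms(1) and T = assms(2) and X = assms(3)
  let ?X = "\<lambda>i t \<omega>. X t \<omega> $ i"
  let ?A = "\<lambda>k. covariation_approx T (?X (fst k)) (?X (snd k))"
  note Xi = continuous_process_vec_nth[OF X]
  have T0: "0 \<le> T" using T by simp
  have A: "continuous_process M T (?A k \<epsilon>)" for k \<epsilon>
    by (rule continuous_process_covariation_approx[OF Xi Xi T0])
  have "admits_global_quadratic_variation M T X" if brackets: "admits_all_mutual_brackets M T X"
  proof -
    have "\<exists>C. continuous_process M T C \<and>
        (\<forall>t\<in>{0..T}. converges_in_prob M (\<lambda>\<epsilon>. ?A k \<epsilon> t) (C t) (at_right 0))" for k
      using brackets covariation_existsD[OF _ T0 Xi Xi]
      unfolding admits_all_mutual_brackets_def by metis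
    then obtain C where C: "\<And>k. continuous_process M T (C k)"
      and lim: "\<And>k t. t \<in> {0..T} \<Longrightarrow> converges_in_prob M (\<lambda>\<epsilon>. ?A k \<epsilon> t) (C k t) (at_right 0)"
      by metis
    have ucp: "converges_ucp M T (?A k) (C k) (at_right 0)"
      and bv: "AE \<omega> in M. bounded_variation T (\<lambda>t. C k t \<omega>)" for k
      using covariation_limit[OF M T Xi[of "fst k"] Xi[of "snd k"]
          C[of "(fst k, fst k)"] C[of k] C[of "(snd k, snd k)"]]
        lim[of _ "(fst k, fst k)"] lim[of _ k] lim[of _ "(snd k, snd k)"] by simp_all
    define Q where "Q = (\<lambda>(\<phi> :: (real ^ 'n) chi) t \<omega>. \<Sum>k\<in>UNIV. chi_coeff \<phi> k * C k t \<omega>)"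
    have "H1 M T X"
      by (rule H1_of_brackets[OF M T X C[of "(i, i)" for i]]) (use lim[of T "(i, i)" for i] T in simp)
    moreover have "H2i M T X Q"
      unfolding H2i_def
    proof (intro allI conjI)
      fix \<phi>
      show "continuous_process M T (Q \<phi>)"
        unfolding Q_def by (rule continuous_process_sum[OF C])
      show "converges_ucp M T (\<lambda>\<epsilon> t \<omega>. LINT s:{0..t}|lborel. blinfun_apply (scaled_increment_tensor T X \<epsilon> s \<omega>) \<phi>)
          (Q \<phi>) (at_right 0)"
        unfolding Q_def
      proof (rule converges_ucp_sum[OF M T finite, where A = ?A])
        show "\<forall>\<^sub>F \<epsilon> in at_right 0. \<forall>k\<in>UNIV. continuous_process M T (?A k \<epsilon>)"
          using A by (intro always_eventually) blast
        show "\<forall>\<^sub>F \<epsilon> in at_right 0. \<forall>t\<in>{0..T}. \<forall>\<omega>\<in>space M.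
            (LINT s:{0..t}|lborel. blinfun_apply (scaled_increment_tensor T X \<epsilon> s \<omega>) \<phi>)
            = (\<Sum>k\<in>UNIV. chi_coeff \<phi> k * ?A k \<epsilon> t \<omega>)"
          by (intro always_eventually allI ballI integral_scaled_increment_tensor[OF X _ T0])
      qed (use C ucp in simp_all)
    qed
    moreover have "H2ii M T Q"
      unfolding Q_def by (rule H2ii_of_brackets[OF T0 C bv])
    ultimately show ?thesis
      unfolding admits_global_quadratic_variation_def by blast
  qed
  moreover have "admits_all_mutual_brackets M T X" if gqv: "admits_global_quadratic_variation M T X"
  proof -
    obtain Q where Q: "H2i M T X Q"
      using gqv unfolding admits_global_quadratic_variation_def by blast
    show ?thesis
      unfolding admits_all_mutual_brackets_def
    proof (intro allI)
      fix i j
      obtain \<phi> :: "(real ^ 'n) chi" where \<phi>: "\<And>x y. blinfun_apply (blinfun_apply \<phi> x) y = x $ i * y $ j"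
        using coordinate_form_exists by blast
      have eq: "(\<lambda>\<epsilon> t \<omega>. LINT s:{0..t}|lborel. blinfun_apply (scaled_increment_tensor T X \<epsilon> s \<omega>) \<phi>)
          = covariation_approx T (?X i) (?X j)"
        by (intro ext) (simp add: scaled_increment_tensor_def covariation_approx_def blinfun.scaleR_left
            tensor_apply \<phi> increment_vec_nth)
      have Q\<phi>: "continuous_process M T (Q \<phi>)"
        and ucp: "converges_ucp M T (covariation_approx T (?X i) (?X j)) (Q \<phi>) (at_right 0)"
        using Q unfolding H2i_def eq[symmetric] by blast+
      have lim: "converges_in_prob M (\<lambda>\<epsilon>. covariation_approx T (?X i) (?X j) \<epsilon> t) (Q \<phi> t) (at_right 0)"
        if "t \<in> {0..T}" for t
        by (rule converges_in_prob_of_ucp[OF M T always_eventually[OF allI] Q\<phi> ucp that])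
           (rule continuous_process_covariation_approx[OF Xi Xi T0])
      show "covariation_exists M T (?X i) (?X j)"
        unfolding covariation_exists_def
        using Q\<phi> lim by (intro exI[of _ "Q \<phi>"] conjI ballI) (auto simp: continuous_process_def)
    qed
  qed
  ultimately show ?thesis by blast
qed

end
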